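(* Let $\mathbb{K}$ be either $\mathbb{R}$ or $\mathbb{Q}_p$ for a prime $p$, and let $F_1,\dots,F_m\in\mathbb{K}[x_1,\dots,x_d]$ be $m\geq 2$ polynomials such that $1,F_1,\dots,F_m$ are linearly independent over $\mathbb{K}$. Then for every $\delta>0$, $$\chi_{\mathrm{Bor}}\big(\mathrm{Cay}(\mathbb{K}^m,S_\delta)\big)=\aleph_0,\qquad S_\delta=\left\{\pm\big(F_1(\mathbf{s}),\dots,F_m(\mathbf{s})\big)\in\mathbb{K}^m:\mathbf{s}\in\mathbb{K}^d\right\}\setminus B_\delta.$$
   Context: $\mathbb{K}^m$ carries the Euclidean norm if $\mathbb{K}=\mathbb{R}$ and the supremum of the $p$-adic absolute values of the coordinates if $\mathbb{K}=\mathbb{Q}_p$; $B_\delta$ is the open-or-closed ball (as defined by this norm) of radius $\delta$ centered at $0$. For a symmetric set $S\subseteq\mathbb{K}^m$ not containing $0$, $\mathrm{Cay}(\mathbb{K}^m,S)$ has vertex set $\mathbb{K}^m$, with $x,y$ adjacent iff $x-y\in S$. Its Borel chromatic number $\chi_{\mathrm{Bor}}$ is the least cardinal $c$ such that $\mathbb{K}^m$ can be partitioned into $c$ Borel sets none of which contains two adjacent vertices. *)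

theory Defs
  imports
    "HOL-Analysis.Analysis"
    "HOL-Library.Poly_Mapping"
    "HOL-Library.Disjoint_Sets"
    "HOL-Computational_Algebra.Primes"
    "Berlekamp_Zassenhaus.Finite_Field"
begin

unbundle cardinal_syntax

text \<open>On nonzero rationals this is \<open>p\<close> to the power minus the p-adic valuation; the library's
  \<open>multiplicity\<close> only covers the numerator and the denominator.\<close>

definition rat_padic_abs :: "nat \<Rightarrow> rat \<Rightarrow> real" where
  "rat_padic_abs p x = (if x = 0 then 0 else
     (case quotient_of x of (a, b) \<Rightarrow>
        real p powi (int (multiplicity (int p) b) - int (multiplicity (int p) a))))"

lemma rat_padic_abs_0 [simp]: "rat_padic_abs p 0 = 0"
  by (simp add: rat_padic_abs_def)

lemma rat_padic_abs_quotient: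
  assumes p: "prime p" and ab: "a \<noteq> 0" "b \<noteq> 0"
  shows "rat_padic_abs p (of_int a / of_int b) =
    real p powi (int (multiplicity (int p) b) - int (multiplicity (int p) a))"
proof -
  obtain c d where cd: "quotient_of (of_int a / of_int b) = (c, d)"
    by fastforce
  have eq: "(of_int a / of_int b :: rat) = of_int c / of_int d"
    using quotient_of_div[OF cd] .
  have d: "d > 0" using quotient_of_denom_pos[OF cd] .
  have c: "c \<noteq> 0" using eq ab d by auto
  have "(of_int (a * d) :: rat) = of_int (c * b)"
    using eq ab d by (simp add: field_simps)
  hence "a * d = c * b" by (simp only: of_int_eq_iff)
  hence "multiplicity (int p) (a * d) = multiplicity (int p) (c * b)" by simp
  moreover have pe: "prime_elem (int p)" using p by (simp add: prime_imp_prime_elem)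
  ultimately have "multiplicity (int p) a + multiplicity (int p) d
      = multiplicity (int p) c + multiplicity (int p) b"
    using ab c d by (simp add: prime_elem_multiplicity_mult_distrib)
  hence "int (multiplicity (int p) d) - int (multiplicity (int p) c)
      = int (multiplicity (int p) b) - int (multiplicity (int p) a)"
    by linarith
  thus ?thesis using ab by (simp add: rat_padic_abs_def cd)
qed

lemma rat_as_quotient:
  obtains a b where "(x::rat) = of_int a / of_int b" "b \<noteq> 0"
  using quotient_of_div quotient_of_denom_pos by (metis less_irrefl prod.collapse)

lemma rat_padic_abs_nonneg [simp]: "0 \<le> rat_padic_abs p x"
  by (auto simp: rat_padic_abs_def split: prod.split)

lemma rat_padic_abs_eq_0 [simp]: "prime p \<Longrightarrow> rat_padic_abs p x = 0 \<longleftrightarrow> x = 0"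
  by (auto simp: rat_padic_abs_def power_int_eq_0_iff split: prod.split)

lemma rat_padic_abs_mult:
  assumes p: "prime p"
  shows "rat_padic_abs p (x * y) = rat_padic_abs p x * rat_padic_abs p y"
proof (cases "x = 0 \<or> y = 0")
  case False
  obtain a b where x: "x = of_int a / of_int b" "b \<noteq> 0" by (rule rat_as_quotient)
  obtain c d where y: "y = of_int c / of_int d" "d \<noteq> 0" by (rule rat_as_quotient)
  have ac: "a \<noteq> 0" "c \<noteq> 0" using False x y by auto
  have xy: "x * y = of_int (a * c) / of_int (b * d)" using x y by simp
  have pe: "prime_elem (int p)" using p by (simp add: prime_imp_prime_elem)
  have p0: "real p \<noteq> 0" using p by auto
  have "rat_padic_abs p (x * y) = real p powi
      ((int (multiplicity (int p) b) - int (multiplicity (int p) a)) +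
       (int (multiplicity (int p) d) - int (multiplicity (int p) c)))"
    unfolding xy using ac x y pe
    by (subst rat_padic_abs_quotient[OF p])
       (auto simp: prime_elem_multiplicity_mult_distrib algebra_simps)
  thus ?thesis using x y ac p0 by (simp add: rat_padic_abs_quotient[OF p] power_int_add)
qed auto

lemma rat_padic_abs_1 [simp]: "prime p \<Longrightarrow> rat_padic_abs p 1 = 1"
  using rat_padic_abs_quotient[of p 1 1] by simp

lemma rat_padic_abs_minus:
  assumes p: "prime p" shows "rat_padic_abs p (- x) = rat_padic_abs p x"
proof -
  have "rat_padic_abs p (-1) * rat_padic_abs p (-1) = 1"
    using rat_padic_abs_mult[OF p, of "-1" "-1"] p by simp
  hence "(rat_padic_abs p (-1))\<^sup>2 = 1\<^sup>2" by (simp add: power2_eq_square)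
  hence "rat_padic_abs p (-1) = 1"
    by (rule power2_eq_imp_eq) simp_all
  thus ?thesis using rat_padic_abs_mult[OF p, of "-1" x] by simp
qed

lemma rat_padic_abs_minus_commute:
  "prime p \<Longrightarrow> rat_padic_abs p (x - y) = rat_padic_abs p (y - x)"
  using rat_padic_abs_minus[of p "x - y"] by simp

lemma rat_padic_abs_inverse:
  assumes p: "prime p" shows "rat_padic_abs p (inverse x) = inverse (rat_padic_abs p x)"
proof (cases "x = 0")
  case False
  have "rat_padic_abs p (inverse x) * rat_padic_abs p x = 1"
    using rat_padic_abs_mult[OF p, of "inverse x" x] False p by simp
  thus ?thesis by (metis inverse_unique mult.commute)
qed auto

lemma rat_padic_abs_of_int_le_1:
  assumes p: "prime p" shows "rat_padic_abs p (of_int a) \<le> 1"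
proof (cases "a = 0")
  case False
  have "rat_padic_abs p (of_int a) = real p powi (- int (multiplicity (int p) a))"
    using rat_padic_abs_quotient[OF p False, of 1] by simp
  also have "\<dots> \<le> 1"
    using prime_ge_1_nat[OF p] by (simp add: power_int_minus inverse_le_1_iff)
  finally show ?thesis .
qed auto

lemma rat_padic_abs_add_aux:
  assumes p: "prime p" and x: "x \<noteq> 0" and le: "rat_padic_abs p y \<le> rat_padic_abs p x"
  shows "rat_padic_abs p (x + y) \<le> rat_padic_abs p x"
proof (cases "y = 0")
  case False
  obtain a b where z: "y / x = of_int a / of_int b" "b \<noteq> 0" by (rule rat_as_quotient)
  have a: "a \<noteq> 0" using z False x by auto
  define e where "e = multiplicity (int p) b"
  have p1: "real p > 1" using prime_gt_1_nat[OF p] by simp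
  have "rat_padic_abs p (y / x) \<le> 1"
    using le x p by (simp add: divide_inverse rat_padic_abs_mult rat_padic_abs_inverse)
      (simp add: field_simps less_le)
  hence "real p powi (int e - int (multiplicity (int p) a)) \<le> real p powi 0"
    using z a by (simp add: rat_padic_abs_quotient[OF p] e_def)
  hence "int e - int (multiplicity (int p) a) \<le> 0"
    using p1 by (metis power_int_le_imp_le_exp less_eq_int_code(1) linorder_not_less
        power_int_strict_increasing)
  hence "e \<le> multiplicity (int p) a" by simp
  hence "int p ^ e dvd a" by (rule multiplicity_dvd')
  moreover have "int p ^ e dvd b" unfolding e_def by (rule multiplicity_dvd)
  ultimately obtain a' b' where ab: "a = int p ^ e * a'" "b = int p ^ e * b'"
    by (auto elim!: dvdE)
  have b': "b' \<noteq> 0" using ab z by auto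
  have pe: "prime_elem (int p)" using p by (simp add: prime_imp_prime_elem)
  have p0: "int p ^ e \<noteq> 0" using prime_gt_0_nat[OF p] by simp
  have "e = multiplicity (int p) (int p ^ e) + multiplicity (int p) b'"
    using ab(2) p0 b' pe e_def prime_elem_multiplicity_mult_distrib by metis
  moreover have "multiplicity (int p) (int p ^ e) = e"
    using p0 pe by (intro multiplicity_same_power) auto
  ultimately have m: "multiplicity (int p) b' = 0" by simp
  have q: "1 + y / x = of_int (a' + b') / of_int b'"
    unfolding z(1) ab using p0 b' prime_gt_0_nat[OF p] by (simp add: field_simps)
  have "rat_padic_abs p (1 / of_int b') = 1"
    using rat_padic_abs_quotient[OF p, of 1 b'] b' m by simp
  hence "rat_padic_abs p (1 + y / x) \<le> 1"
    unfolding q using rat_padic_abs_of_int_le_1[OF p, of "a' + b'"]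
      rat_padic_abs_mult[OF p, of "of_int (a' + b')" "1 / of_int b'"] by simp
  hence "rat_padic_abs p x * rat_padic_abs p (1 + y / x) \<le> rat_padic_abs p x"
    by (simp add: mult_left_le)
  moreover have "x + y = x * (1 + y / x)" using x by (simp add: field_simps)
  ultimately show ?thesis by (metis rat_padic_abs_mult[OF p])
qed auto

lemma rat_padic_abs_add:
  assumes p: "prime p"
  shows "rat_padic_abs p (x + y) \<le> max (rat_padic_abs p x) (rat_padic_abs p y)"
proof (cases "x = 0 \<or> y = 0")
  case False
  thus ?thesis
    using rat_padic_abs_add_aux[OF p, of x y] rat_padic_abs_add_aux[OF p, of y x]
    by (auto simp: max_def add.commute)
qed auto

lemma rat_padic_abs_add_le:
  "prime p \<Longrightarrow> rat_padic_abs p (x + y) \<le> rat_padic_abs p x + rat_padic_abs p y"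
  using rat_padic_abs_add[of p x y] rat_padic_abs_nonneg[of p x] rat_padic_abs_nonneg[of p y]
  by linarith

lemma rat_padic_abs_diff:
  "prime p \<Longrightarrow> rat_padic_abs p (x - y) \<le> max (rat_padic_abs p x) (rat_padic_abs p y)"
  using rat_padic_abs_add[of p x "- y"] by (simp add: rat_padic_abs_minus)

definition padic_Cauchy :: "nat \<Rightarrow> (nat \<Rightarrow> rat) \<Rightarrow> bool" where
  "padic_Cauchy p X \<longleftrightarrow>
     (\<forall>e>0. \<exists>M. \<forall>m\<ge>M. \<forall>n\<ge>M. rat_padic_abs p (X m - X n) < e)"

definition padic_vanishes :: "nat \<Rightarrow> (nat \<Rightarrow> rat) \<Rightarrow> bool" where
  "padic_vanishes p X \<longleftrightarrow> (\<lambda>n. rat_padic_abs p (X n)) \<longlonglongrightarrow> 0"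

lemma padic_CauchyE:
  assumes "padic_Cauchy p X" "e > 0"
  obtains M where "\<And>m n. m \<ge> M \<Longrightarrow> n \<ge> M \<Longrightarrow> rat_padic_abs p (X m - X n) < e"
  using assms unfolding padic_Cauchy_def by blast

lemma padic_Cauchy_const [simp]: "padic_Cauchy p (\<lambda>_. c)"
  by (simp add: padic_Cauchy_def)

lemma padic_vanishes_const [simp]: "prime p \<Longrightarrow> padic_vanishes p (\<lambda>_. c) \<longleftrightarrow> c = 0"
  by (simp add: padic_vanishes_def LIMSEQ_const_iff)

lemma padic_vanishes_minus: "prime p \<Longrightarrow> padic_vanishes p X \<Longrightarrow> padic_vanishes p (\<lambda>n. - X n)"
  by (simp add: padic_vanishes_def rat_padic_abs_minus)

lemma padic_vanishes_add:
  assumes p: "prime p" and X: "padic_vanishes p X" and Y: "padic_vanishes p Y"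
  shows "padic_vanishes p (\<lambda>n. X n + Y n)"
  unfolding padic_vanishes_def
proof (rule tendsto_sandwich[where f = "\<lambda>_. 0"])
  show "(\<lambda>n. rat_padic_abs p (X n) + rat_padic_abs p (Y n)) \<longlonglongrightarrow> 0"
    using X Y unfolding padic_vanishes_def by (auto intro: tendsto_add_zero)
qed (auto simp: rat_padic_abs_add_le[OF p])

lemma padic_vanishes_mult_bounded:
  assumes p: "prime p" and X: "\<And>n. rat_padic_abs p (X n) \<le> c" and Y: "padic_vanishes p Y"
  shows "padic_vanishes p (\<lambda>n. X n * Y n)"
  unfolding padic_vanishes_def
proof (rule tendsto_sandwich[where f = "\<lambda>_. 0"])
  show "(\<lambda>n. c * rat_padic_abs p (Y n)) \<longlonglongrightarrow> 0"
    using Y unfolding padic_vanishes_def by (auto intro: tendsto_mult_right_zero)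
qed (auto simp: rat_padic_abs_mult[OF p] intro!: always_eventually mult_right_mono X)

lemma padic_Cauchy_minus: "prime p \<Longrightarrow> padic_Cauchy p X \<Longrightarrow> padic_Cauchy p (\<lambda>n. - X n)"
  unfolding padic_Cauchy_def minus_diff_minus by (simp only: rat_padic_abs_minus)

lemma padic_Cauchy_add:
  assumes p: "prime p" and X: "padic_Cauchy p X" and Y: "padic_Cauchy p Y"
  shows "padic_Cauchy p (\<lambda>n. X n + Y n)"
  unfolding padic_Cauchy_def
proof safe
  fix e :: real assume e: "e > 0"
  obtain M where M: "\<And>m n. m \<ge> M \<Longrightarrow> n \<ge> M \<Longrightarrow> rat_padic_abs p (X m - X n) < e"
    using padic_CauchyE[OF X e] by blast
  obtain N where N: "\<And>m n. m \<ge> N \<Longrightarrow> n \<ge> N \<Longrightarrow> rat_padic_abs p (Y m - Y n) < e"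
    using padic_CauchyE[OF Y e] by blast
  have "rat_padic_abs p ((X m + Y m) - (X n + Y n)) < e" if "m \<ge> max M N" "n \<ge> max M N" for m n
  proof -
    have "(X m + Y m) - (X n + Y n) = (X m - X n) + (Y m - Y n)" by simp
    hence "rat_padic_abs p ((X m + Y m) - (X n + Y n))
       \<le> max (rat_padic_abs p (X m - X n)) (rat_padic_abs p (Y m - Y n))"
      by (simp only: rat_padic_abs_add[OF p])
    thus ?thesis using M[of m n] N[of m n] that by auto
  qed
  thus "\<exists>M. \<forall>m\<ge>M. \<forall>n\<ge>M. rat_padic_abs p ((X m + Y m) - (X n + Y n)) < e" by blast
qed

lemma padic_Cauchy_bounded:
  assumes p: "prime p" and X: "padic_Cauchy p X"
  obtains c where "c > 0" "\<And>n. rat_padic_abs p (X n) \<le> c"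
proof -
  obtain M where M: "\<And>m n. m \<ge> M \<Longrightarrow> n \<ge> M \<Longrightarrow> rat_padic_abs p (X m - X n) < 1"
    using padic_CauchyE[OF X zero_less_one] by blast
  define c where "c = Max (insert 1 ((\<lambda>n. rat_padic_abs p (X n)) ` {..M}))"
  have c1: "1 \<le> c" unfolding c_def by (intro Max_ge) auto
  have c2: "rat_padic_abs p (X n) \<le> c" if "n \<le> M" for n
    unfolding c_def using that by (intro Max_ge) auto
  have "rat_padic_abs p (X n) \<le> c" for n
  proof (cases "n \<le> M")
    case False
    have "rat_padic_abs p ((X n - X M) + X M) \<le> max (rat_padic_abs p (X n - X M)) (rat_padic_abs p (X M))"
      by (rule rat_padic_abs_add[OF p])
    thus ?thesis using M[of n M] False c1 c2[of M] by auto
  qed (use c2 in auto)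
  thus ?thesis using that[of c] c1 by auto
qed

lemma padic_Cauchy_mult:
  assumes p: "prime p" and X: "padic_Cauchy p X" and Y: "padic_Cauchy p Y"
  shows "padic_Cauchy p (\<lambda>n. X n * Y n)"
  unfolding padic_Cauchy_def
proof safe
  fix e :: real assume e: "e > 0"
  obtain a where a: "a > 0" "\<And>n. rat_padic_abs p (X n) \<le> a"
    using padic_Cauchy_bounded[OF p X] by blast
  obtain b where b: "b > 0" "\<And>n. rat_padic_abs p (Y n) \<le> b"
    using padic_Cauchy_bounded[OF p Y] by blast
  obtain M where M: "\<And>m n. m \<ge> M \<Longrightarrow> n \<ge> M \<Longrightarrow> rat_padic_abs p (X m - X n) < e / b"
    using padic_CauchyE[OF X divide_pos_pos[OF e b(1)]] by blast
  obtain N where N: "\<And>m n. m \<ge> N \<Longrightarrow> n \<ge> N \<Longrightarrow> rat_padic_abs p (Y m - Y n) < e / a"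
    using padic_CauchyE[OF Y divide_pos_pos[OF e a(1)]] by blast
  have "rat_padic_abs p (X m * Y m - X n * Y n) < e" if "m \<ge> max M N" "n \<ge> max M N" for m n
  proof -
    have "X m * Y m - X n * Y n = X m * (Y m - Y n) + (X m - X n) * Y n"
      by (simp add: algebra_simps)
    hence "rat_padic_abs p (X m * Y m - X n * Y n)
       \<le> max (rat_padic_abs p (X m) * rat_padic_abs p (Y m - Y n))
             (rat_padic_abs p (X m - X n) * rat_padic_abs p (Y n))"
      using rat_padic_abs_add[OF p, of "X m * (Y m - Y n)" "(X m - X n) * Y n"]
      by (simp add: rat_padic_abs_mult[OF p])
    moreover have "rat_padic_abs p (X m) * rat_padic_abs p (Y m - Y n) < e"
    proof -
      have "rat_padic_abs p (X m) * rat_padic_abs p (Y m - Y n) \<le> a * rat_padic_abs p (Y m - Y n)"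
        by (intro mult_right_mono a) auto
      also have "\<dots> < a * (e / a)"
        using N[of m n] that a(1) by (intro mult_strict_left_mono) auto
      finally show ?thesis using a(1) by simp
    qed
    moreover have "rat_padic_abs p (X m - X n) * rat_padic_abs p (Y n) < e"
    proof -
      have "rat_padic_abs p (X m - X n) * rat_padic_abs p (Y n) \<le> rat_padic_abs p (X m - X n) * b"
        by (intro mult_left_mono b) auto
      also have "\<dots> < (e / b) * b"
        using M[of m n] that b(1) by (intro mult_strict_right_mono) auto
      finally show ?thesis using b(1) by simp
    qed
    ultimately show ?thesis by linarith
  qed
  thus "\<exists>M. \<forall>m\<ge>M. \<forall>n\<ge>M. rat_padic_abs p (X m * Y m - X n * Y n) < e" by blast
qed

lemma padic_Cauchy_not_vanishes:
  assumes p: "prime p" and X: "padic_Cauchy p X" and nv: "\<not> padic_vanishes p X"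
  shows "\<exists>M c. c > 0 \<and> (\<forall>n\<ge>M. rat_padic_abs p (X n) = c)"
proof -
  have "\<exists>e>0. \<forall>M. \<exists>n\<ge>M. e \<le> rat_padic_abs p (X n)"
    using nv unfolding padic_vanishes_def LIMSEQ_iff by (simp add: not_less)
  then obtain e where e: "e > 0" "\<And>M. \<exists>n\<ge>M. e \<le> rat_padic_abs p (X n)" by blast
  obtain M where M: "\<And>m n. m \<ge> M \<Longrightarrow> n \<ge> M \<Longrightarrow> rat_padic_abs p (X m - X n) < e"
    using padic_CauchyE[OF X e(1)] by blast
  obtain k where k: "k \<ge> M" "e \<le> rat_padic_abs p (X k)" using e(2) by blast
  have const: "rat_padic_abs p (X n) = rat_padic_abs p (X k)" if "n \<ge> M" for n
  proof (rule antisym)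
    have lt: "rat_padic_abs p (X n - X k) < rat_padic_abs p (X k)"
      using M[of n k] k that by linarith
    show "rat_padic_abs p (X n) \<le> rat_padic_abs p (X k)"
      using rat_padic_abs_add[OF p, of "X n - X k" "X k"] lt by (simp add: max_def split: if_splits)
    show "rat_padic_abs p (X k) \<le> rat_padic_abs p (X n)"
      using rat_padic_abs_diff[OF p, of "X n" "X n - X k"] lt by (simp add: max_def split: if_splits)
  qed
  have "0 < rat_padic_abs p (X k)" using e(1) k(2) by linarith
  thus ?thesis using const by (intro exI[of _ M] exI[of _ "rat_padic_abs p (X k)"]) simp
qed

lemma padic_Cauchy_inverse:
  assumes p: "prime p" and X: "padic_Cauchy p X" and nv: "\<not> padic_vanishes p X"
  shows "padic_Cauchy p (\<lambda>n. inverse (X n))"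
  unfolding padic_Cauchy_def
proof safe
  fix e :: real assume e: "e > 0"
  obtain M c where cc0: "c > 0 \<and> (\<forall>n\<ge>M. rat_padic_abs p (X n) = c)"
    using padic_Cauchy_not_vanishes[OF p X nv] by (elim exE) (rule that)
  have c: "c > 0" "\<And>n. n \<ge> M \<Longrightarrow> rat_padic_abs p (X n) = c"
    using cc0 by simp_all
  obtain N where N: "\<And>m n. m \<ge> N \<Longrightarrow> n \<ge> N \<Longrightarrow> rat_padic_abs p (X m - X n) < e * (c * c)"
    using padic_CauchyE[OF X mult_pos_pos[OF e mult_pos_pos[OF c(1) c(1)]]] by blast
  have "rat_padic_abs p (inverse (X m) - inverse (X n)) < e" if "m \<ge> max M N" "n \<ge> max M N" for m n
  proof -
    have cc: "rat_padic_abs p (X m) = c" "rat_padic_abs p (X n) = c"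
      using c(2) that by simp_all
    have nz: "X m \<noteq> 0" "X n \<noteq> 0"
      using cc c(1) by (metis less_irrefl rat_padic_abs_0)+
    have "inverse (X m) - inverse (X n) = (X n - X m) * inverse (X m) * inverse (X n)"
      using nz by (simp add: left_diff_distrib)
    hence "rat_padic_abs p (inverse (X m) - inverse (X n)) = rat_padic_abs p (X n - X m) * inverse c * inverse c"
      by (simp add: rat_padic_abs_mult[OF p] rat_padic_abs_inverse[OF p] cc)
    also have "\<dots> < e * (c * c) * inverse c * inverse c"
      using N[of n m] that c(1) by (intro mult_strict_right_mono) simp_all
    also have "\<dots> = e" using c(1) by (simp add: field_simps)
    finally show ?thesis .
  qed
  thus "\<exists>M. \<forall>m\<ge>M. \<forall>n\<ge>M. rat_padic_abs p (inverse (X m) - inverse (X n)) < e" by blast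
qed

lemma padic_vanishes_eq_diff:
  assumes p: "prime p" and XY: "padic_vanishes p (\<lambda>n. X n - Y n)"
  shows "padic_vanishes p X \<longleftrightarrow> padic_vanishes p Y"
  using padic_vanishes_add[OF p XY, of Y]
    padic_vanishes_add[OF p _ padic_vanishes_minus[OF p XY], of X] by auto

lemma padic_vanishes_diff_inverse:
  assumes p: "prime p" and X: "padic_Cauchy p X" and Y: "padic_Cauchy p Y"
    and nv: "\<not> padic_vanishes p X" "\<not> padic_vanishes p Y"
    and XY: "padic_vanishes p (\<lambda>n. X n - Y n)"
  shows "padic_vanishes p (\<lambda>n. inverse (X n) - inverse (Y n))"
proof -
  obtain M c where cc0: "c > 0 \<and> (\<forall>n\<ge>M. rat_padic_abs p (X n) = c)"
    using padic_Cauchy_not_vanishes[OF p X nv(1)] by (elim exE) (rule that)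
  have c: "c > 0" "\<And>n. n \<ge> M \<Longrightarrow> rat_padic_abs p (X n) = c"
    using cc0 by simp_all
  obtain N d where dd0: "d > 0 \<and> (\<forall>n\<ge>N. rat_padic_abs p (Y n) = d)"
    using padic_Cauchy_not_vanishes[OF p Y nv(2)] by (elim exE) (rule that)
  have d: "d > 0" "\<And>n. n \<ge> N \<Longrightarrow> rat_padic_abs p (Y n) = d"
    using dd0 by simp_all
  have "rat_padic_abs p (inverse (X n) - inverse (Y n)) = rat_padic_abs p (X n - Y n) * inverse (c * d)"
    if "n \<ge> max M N" for n
  proof -
    have cd: "rat_padic_abs p (X n) = c" "rat_padic_abs p (Y n) = d"
      using c(2) d(2) that by simp_all
    have nz: "X n \<noteq> 0" "Y n \<noteq> 0"
      using cd c(1) d(1) by (metis less_irrefl rat_padic_abs_0)+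
    have "inverse (X n) - inverse (Y n) = (Y n - X n) * inverse (X n) * inverse (Y n)"
      using nz by (simp add: left_diff_distrib)
    thus ?thesis
      by (simp add: rat_padic_abs_mult[OF p] rat_padic_abs_inverse[OF p] cd
          rat_padic_abs_minus_commute[OF p, of "X n" "Y n"])
  qed
  hence "\<forall>\<^sub>F n in sequentially. rat_padic_abs p (X n - Y n) * inverse (c * d)
      = rat_padic_abs p (inverse (X n) - inverse (Y n))"
    unfolding eventually_sequentially by (intro exI[of _ "max M N"]) simp
  moreover have "(\<lambda>n. rat_padic_abs p (X n - Y n) * inverse (c * d)) \<longlonglongrightarrow> 0"
    using XY unfolding padic_vanishes_def by (auto intro: tendsto_mult_left_zero)
  ultimately show ?thesis
    unfolding padic_vanishes_def by (rule Lim_transform_eventually[rotated])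
qed

lemma padic_Cauchy_abs_convergent:
  assumes p: "prime p" and X: "padic_Cauchy p X"
  shows "convergent (\<lambda>n. rat_padic_abs p (X n))"
proof (cases "padic_vanishes p X")
  case True
  thus ?thesis by (auto simp: padic_vanishes_def convergent_def)
next
  case False
  obtain M c where cc0: "c > 0 \<and> (\<forall>n\<ge>M. rat_padic_abs p (X n) = c)"
    using padic_Cauchy_not_vanishes[OF p X False] by (elim exE) (rule that)
  have c: "c > 0" "\<And>n. n \<ge> M \<Longrightarrow> rat_padic_abs p (X n) = c"
    using cc0 by simp_all
  have "(\<lambda>n. rat_padic_abs p (X n)) \<longlonglongrightarrow> c"
    by (rule tendsto_eventually) (auto simp: eventually_sequentially c intro!: exI[of _ M])
  thus ?thesis by (auto simp: convergent_def)
qed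

text \<open>
  The prime is carried by a type: \<open>'a padic\<close> is the completion of the rationals for
  the p-adic absolute value with \<open>p = CARD('a)\<close>, and class \<open>prime_card\<close> says that this
  cardinality is prime.
\<close>

definition padic_rel :: "nat \<Rightarrow> (nat \<Rightarrow> rat) \<Rightarrow> (nat \<Rightarrow> rat) \<Rightarrow> bool" where
  "padic_rel p X Y \<longleftrightarrow>
     padic_Cauchy p X \<and> padic_Cauchy p Y \<and> padic_vanishes p (\<lambda>n. X n - Y n)"

lemma part_equivp_padic_rel:
  assumes p: "prime p" shows "part_equivp (padic_rel p)"
proof (rule part_equivpI)
  show "\<exists>X. padic_rel p X X"
    by (rule exI[of _ "\<lambda>_. 0"]) (simp add: padic_rel_def p)
  show "symp (padic_rel p)"
    using padic_vanishes_minus[OF p] by (fastforce simp: padic_rel_def symp_def)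
  show "transp (padic_rel p)"
    using padic_vanishes_add[OF p] by (fastforce simp: padic_rel_def transp_def)
qed

typedef (overloaded) ('a::prime_card) padic =
  "{X. padic_Cauchy CARD('a) X} // {(X, Y). padic_rel CARD('a) X Y}"
  by (rule exI, rule quotientI[of "\<lambda>_. 0"]) simp

definition abs_padic :: "(nat \<Rightarrow> rat) \<Rightarrow> 'a::prime_card padic" where
  "abs_padic X = Abs_padic {Y. padic_rel CARD('a) X Y}"

definition rep_padic :: "'a::prime_card padic \<Rightarrow> (nat \<Rightarrow> rat)" where
  "rep_padic x = (SOME X. X \<in> Rep_padic x)"

definition cr_padic :: "(nat \<Rightarrow> rat) \<Rightarrow> 'a::prime_card padic \<Rightarrow> bool" where
  "cr_padic X x \<longleftrightarrow> padic_rel CARD('a) X X \<and> abs_padic X = x"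

lemma padic_rel_refl_iff: "prime p \<Longrightarrow> padic_rel p X X \<longleftrightarrow> padic_Cauchy p X"
  by (simp add: padic_rel_def)

lemma Quotient_padic:
  "Quotient (padic_rel CARD('a::prime_card)) abs_padic rep_padic (cr_padic :: _ \<Rightarrow> 'a padic \<Rightarrow> bool)"
proof -
  let ?R = "padic_rel CARD('a)"
  note p = prime_card[where 'a = 'a]
  have sym: "?R X Y \<Longrightarrow> ?R Y X" for X Y
    using part_equivp_symp[OF part_equivp_padic_rel[OF p]] .
  have trans: "?R X Y \<Longrightarrow> ?R Y Z \<Longrightarrow> ?R X Z" for X Y Z
    using part_equivp_transp[OF part_equivp_padic_rel[OF p]] .
  have refl: "?R X X \<longleftrightarrow> padic_Cauchy CARD('a) X" for X by (rule padic_rel_refl_iff[OF p])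
  have Rep_abs: "Rep_padic (abs_padic X :: 'a padic) = {Y. ?R X Y}" if "?R X X" for X
    unfolding abs_padic_def
    using that by (intro Abs_padic_inverse) (auto simp: quotient_def refl Image_def)
  have Rep: "\<exists>X. ?R X X \<and> Rep_padic x = {Y. ?R X Y}" for x :: "'a padic"
    using Rep_padic[of x] by (auto simp: quotient_def refl Image_def)
  have rep: "?R (rep_padic x) (rep_padic x) \<and> Rep_padic x = {Y. ?R (rep_padic x) Y}" for x :: "'a padic"
  proof -
    obtain X where X: "?R X X" "Rep_padic x = {Y. ?R X Y}" using Rep by blast
    have "rep_padic x \<in> Rep_padic x"
      unfolding rep_padic_def using X by (metis (mono_tags) mem_Collect_eq someI)
    hence "?R X (rep_padic x)" using X by simp
    thus ?thesis using X sym trans by blast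
  qed
  show ?thesis
    unfolding Quotient_alt_def3
  proof (intro conjI allI impI)
    show "abs_padic X = x" if "cr_padic X x" for X and x :: "'a padic"
      using that by (simp add: cr_padic_def)
    show "cr_padic (rep_padic x) x" for x :: "'a padic"
      unfolding cr_padic_def using rep[of x] Rep_abs[of "rep_padic x"]
      by (metis Rep_padic_inject)
    show "?R X Y \<longleftrightarrow> (\<exists>z. cr_padic X (z :: 'a padic) \<and> cr_padic Y z)" for X Y
    proof
      assume XY: "?R X Y"
      hence r: "?R X X" "?R Y Y" using sym trans by blast+
      have "{Z. ?R X Z} = {Z. ?R Y Z}" using XY sym trans by blast
      thus "\<exists>z :: 'a padic. cr_padic X z \<and> cr_padic Y z"
        using r by (auto simp: cr_padic_def abs_padic_def)
    next
      assume "\<exists>z :: 'a padic. cr_padic X z \<and> cr_padic Y z"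
      hence r: "?R X X" "?R Y Y" "(abs_padic X :: 'a padic) = abs_padic Y"
        by (auto simp: cr_padic_def)
      hence "{Z. ?R X Z} = {Z. ?R Y Z}" using Rep_abs by metis
      thus "?R X Y" using r by blast
    qed
  qed
qed

setup_lifting Quotient_padic

instantiation padic :: (prime_card) field
begin

lift_definition zero_padic :: "'a padic" is "\<lambda>_. 0"
  by (simp add: padic_rel_def prime_card)

lift_definition one_padic :: "'a padic" is "\<lambda>_. 1"
  by (simp add: padic_rel_def prime_card)

lift_definition plus_padic :: "'a padic \<Rightarrow> 'a padic \<Rightarrow> 'a padic" is "\<lambda>X Y n. X n + Y n"
proof -
  fix X X' Y Y' :: "nat \<Rightarrow> rat"
  let ?p = "CARD('a)"
  note p = prime_card[where 'a = 'a]
  assume R: "padic_rel ?p X X'" "padic_rel ?p Y Y'"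
  have "padic_vanishes ?p (\<lambda>n. (X n - X' n) + (Y n - Y' n))"
    using R by (intro padic_vanishes_add[OF p]) (simp_all add: padic_rel_def)
  thus "padic_rel ?p (\<lambda>n. X n + Y n) (\<lambda>n. X' n + Y' n)"
    using R padic_Cauchy_add[OF p, of X Y] padic_Cauchy_add[OF p, of X' Y']
    by (simp add: padic_rel_def add_diff_add)
qed

lift_definition uminus_padic :: "'a padic \<Rightarrow> 'a padic" is "\<lambda>X n. - X n"
proof -
  fix X Y :: "nat \<Rightarrow> rat"
  let ?p = "CARD('a)"
  note p = prime_card[where 'a = 'a]
  assume R: "padic_rel ?p X Y"
  have "padic_vanishes ?p (\<lambda>n. - (X n - Y n))"
    using R by (intro padic_vanishes_minus[OF p]) (simp add: padic_rel_def)
  thus "padic_rel ?p (\<lambda>n. - X n) (\<lambda>n. - Y n)"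
    using R padic_Cauchy_minus[OF p, of X] padic_Cauchy_minus[OF p, of Y]
    by (simp add: padic_rel_def)
qed

lift_definition times_padic :: "'a padic \<Rightarrow> 'a padic \<Rightarrow> 'a padic" is "\<lambda>X Y n. X n * Y n"
proof -
  fix X X' Y Y' :: "nat \<Rightarrow> rat"
  let ?p = "CARD('a)"
  assume X: "padic_rel ?p X X'" and Y: "padic_rel ?p Y Y'"
  note p = prime_card[where 'a = 'a]
  have C: "padic_Cauchy ?p X" "padic_Cauchy ?p Y'"
    using X Y by (simp_all add: padic_rel_def)
  obtain a where a: "\<And>n. rat_padic_abs ?p (X n) \<le> a"
    using padic_Cauchy_bounded[OF p C(1)] by blast
  obtain b where b: "\<And>n. rat_padic_abs ?p (Y' n) \<le> b"
    using padic_Cauchy_bounded[OF p C(2)] by blast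
  have "padic_vanishes ?p (\<lambda>n. X n * (Y n - Y' n) + Y' n * (X n - X' n))"
    using X Y unfolding padic_rel_def
    by (intro padic_vanishes_add[OF p] padic_vanishes_mult_bounded[OF p]) (auto intro: a b)
  moreover have "(\<lambda>n. X n * (Y n - Y' n) + Y' n * (X n - X' n)) = (\<lambda>n. X n * Y n - X' n * Y' n)"
    by (simp add: algebra_simps)
  ultimately show "padic_rel ?p (\<lambda>n. X n * Y n) (\<lambda>n. X' n * Y' n)"
    using X Y padic_Cauchy_mult[OF p, of X Y] padic_Cauchy_mult[OF p, of X' Y']
    by (simp add: padic_rel_def)
qed

lift_definition inverse_padic :: "'a padic \<Rightarrow> 'a padic"
  is "\<lambda>X. if padic_vanishes CARD('a) X then (\<lambda>_. 0) else (\<lambda>n. inverse (X n))"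
proof -
  fix X Y :: "nat \<Rightarrow> rat"
  let ?p = "CARD('a)"
  note p = prime_card[where 'a = 'a]
  assume "padic_rel ?p X Y"
  hence XY: "padic_Cauchy ?p X" "padic_Cauchy ?p Y" "padic_vanishes ?p (\<lambda>n. X n - Y n)"
    by (simp_all add: padic_rel_def)
  note iff = padic_vanishes_eq_diff[OF p XY(3)]
  show "padic_rel ?p (if padic_vanishes ?p X then (\<lambda>_. 0) else (\<lambda>n. inverse (X n)))
                     (if padic_vanishes ?p Y then (\<lambda>_. 0) else (\<lambda>n. inverse (Y n)))"
  proof (cases "padic_vanishes ?p X")
    case True
    thus ?thesis using iff by (simp add: padic_rel_def p)
  next
    case False
    hence nv: "\<not> padic_vanishes ?p Y" using iff by simp
    show ?thesis
      using False nv padic_Cauchy_inverse[OF p XY(1) False] padic_Cauchy_inverse[OF p XY(2) nv]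
        padic_vanishes_diff_inverse[OF p XY(1,2) False nv XY(3)]
      by (simp add: padic_rel_def)
  qed
qed

definition minus_padic :: "'a padic \<Rightarrow> 'a padic \<Rightarrow> 'a padic" where
  "minus_padic x y = x + - y"

definition divide_padic :: "'a padic \<Rightarrow> 'a padic \<Rightarrow> 'a padic" where
  "x div y = x * inverse y" for x y :: "'a padic"

instance
proof
  note p = prime_card[where 'a = 'a]
  fix a b c :: "'a padic"
  show "a + b + c = a + (b + c)"
    by transfer (auto simp: padic_rel_def algebra_simps p intro!: padic_Cauchy_add[OF p])
  show "a + b = b + a"
    by transfer (auto simp: padic_rel_def algebra_simps p intro!: padic_Cauchy_add[OF p])
  show "0 + a = a"
    by transfer (auto simp: padic_rel_def p)
  show "- a + a = 0"
    by transfer (auto simp: padic_rel_def p)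
  show "a - b = a + - b" by (simp add: minus_padic_def)
  show "a * b * c = a * (b * c)"
    by transfer (auto simp: padic_rel_def algebra_simps p intro!: padic_Cauchy_mult[OF p])
  show "a * b = b * a"
    by transfer (auto simp: padic_rel_def algebra_simps p intro!: padic_Cauchy_mult[OF p])
  show "1 * a = a"
    by transfer (auto simp: padic_rel_def p)
  show "(a + b) * c = a * c + b * c"
    by transfer (auto simp: padic_rel_def algebra_simps p
        intro!: padic_Cauchy_add[OF p] padic_Cauchy_mult[OF p])
  show "(0 :: 'a padic) \<noteq> 1"
    by transfer (simp add: padic_rel_def p)
  show "a div b = a * inverse b" by (simp add: divide_padic_def)
  show "inverse (0 :: 'a padic) = 0"
    by transfer (simp add: padic_rel_def p)
  show "a \<noteq> 0 \<Longrightarrow> inverse a * a = 1"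
  proof transfer
    fix X assume X: "padic_rel CARD('a) X X" and nz: "\<not> padic_rel CARD('a) X (\<lambda>_. 0)"
    have C: "padic_Cauchy CARD('a) X" using X by (simp add: padic_rel_def)
    have nv: "\<not> padic_vanishes CARD('a) X" using nz C by (simp add: padic_rel_def)
    obtain M c where cc0: "c > 0 \<and> (\<forall>n\<ge>M. rat_padic_abs CARD('a) (X n) = c)"
      using padic_Cauchy_not_vanishes[OF p C nv] by (elim exE) (rule that)
    have c: "c > 0" "\<And>n. n \<ge> M \<Longrightarrow> rat_padic_abs CARD('a) (X n) = c"
      using cc0 by simp_all
    have "X n \<noteq> 0" if "n \<ge> M" for n using c(1) c(2)[OF that] by auto
    hence "padic_vanishes CARD('a) (\<lambda>n. inverse (X n) * X n - 1)"
      unfolding padic_vanishes_def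
      by (intro tendsto_eventually) (auto simp: eventually_sequentially intro!: exI[of _ M])
    thus "padic_rel CARD('a) (\<lambda>n. (if padic_vanishes CARD('a) X then (\<lambda>_. 0) else (\<lambda>n. inverse (X n))) n * X n) (\<lambda>_. 1)"
      using C nv padic_Cauchy_inverse[OF p C nv]
      by (simp add: padic_rel_def padic_Cauchy_mult[OF p])
  qed
qed

end

lift_definition padic_norm :: "'a::prime_card padic \<Rightarrow> real" is "\<lambda>X. lim (\<lambda>n. rat_padic_abs CARD('a) (X n))"
proof -
  fix X Y :: "nat \<Rightarrow> rat"
  let ?p = "CARD('a)"
  note p = prime_card[where 'a = 'a]
  assume XY: "padic_rel ?p X Y"
  let ?N = "rat_padic_abs ?p"
  have D: "(\<lambda>n. ?N (X n - Y n)) \<longlonglongrightarrow> 0"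
    using XY by (simp add: padic_rel_def padic_vanishes_def)
  have bound: "norm (?N (X n) - ?N (Y n)) \<le> ?N (X n - Y n)" for n
    using rat_padic_abs_add_le[OF p, of "X n - Y n" "Y n"]
      rat_padic_abs_add_le[OF p, of "Y n - X n" "X n"]
      rat_padic_abs_minus_commute[OF p, of "X n" "Y n"] by simp
  have Z: "(\<lambda>n. ?N (X n) - ?N (Y n)) \<longlonglongrightarrow> 0"
    by (rule Lim_null_comparison[OF always_eventually D]) (use bound in blast)
  obtain l where l: "(\<lambda>n. ?N (Y n)) \<longlonglongrightarrow> l"
    using padic_Cauchy_abs_convergent[OF p] XY by (auto simp: padic_rel_def convergent_def)
  have "(\<lambda>n. ?N (X n)) \<longlonglongrightarrow> l"
    using tendsto_add[OF Z l] by simp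
  thus "lim (\<lambda>n. ?N (X n)) = lim (\<lambda>n. ?N (Y n))" using l by (simp add: limI)
qed

lemma padic_abs_lim:
  assumes "padic_Cauchy CARD('a::prime_card) X"
  shows "(\<lambda>n. rat_padic_abs CARD('a) (X n)) \<longlonglongrightarrow> lim (\<lambda>n. rat_padic_abs CARD('a) (X n))"
  using padic_Cauchy_abs_convergent[OF prime_card[where 'a = 'a] assms] convergent_LIMSEQ_iff by blast

lemma padic_norm_eq_0: "padic_norm (x ::'a::prime_card padic) = 0 \<longleftrightarrow> x = 0"
proof transfer
  fix X assume "padic_rel CARD('a) X X"
  hence C: "padic_Cauchy CARD('a) X" by (simp add: padic_rel_def)
  show "lim (\<lambda>n. rat_padic_abs CARD('a) (X n)) = 0 \<longleftrightarrow> padic_rel CARD('a) X (\<lambda>_. 0)"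
    using padic_abs_lim[OF C] C limI[of "\<lambda>n. rat_padic_abs CARD('a) (X n)" 0]
    by (auto simp: padic_rel_def padic_vanishes_def)
qed

lemma padic_norm_minus: "padic_norm (- x ::'a::prime_card padic) = padic_norm x"
  by transfer (simp add: rat_padic_abs_minus[OF prime_card])

lemma padic_norm_ultrametric: "padic_norm (x + y ::'a::prime_card padic) \<le> max (padic_norm x) (padic_norm y)"
proof transfer
  fix X Y assume "padic_rel CARD('a) X X" "padic_rel CARD('a) Y Y"
  hence C: "padic_Cauchy CARD('a) X" "padic_Cauchy CARD('a) Y" by (simp_all add: padic_rel_def)
  show "lim (\<lambda>n. rat_padic_abs CARD('a) (X n + Y n))
     \<le> max (lim (\<lambda>n. rat_padic_abs CARD('a) (X n))) (lim (\<lambda>n. rat_padic_abs CARD('a) (Y n)))"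
  proof (rule LIMSEQ_le)
    show "(\<lambda>n. rat_padic_abs CARD('a) (X n + Y n)) \<longlonglongrightarrow> lim (\<lambda>n. rat_padic_abs CARD('a) (X n + Y n))"
      by (rule padic_abs_lim) (rule padic_Cauchy_add[OF prime_card C])
    show "(\<lambda>n. max (rat_padic_abs CARD('a) (X n)) (rat_padic_abs CARD('a) (Y n)))
      \<longlonglongrightarrow> max (lim (\<lambda>n. rat_padic_abs CARD('a) (X n))) (lim (\<lambda>n. rat_padic_abs CARD('a) (Y n)))"
      by (intro tendsto_max padic_abs_lim C)
    show "\<exists>N. \<forall>n\<ge>N. rat_padic_abs CARD('a) (X n + Y n)
        \<le> max (rat_padic_abs CARD('a) (X n)) (rat_padic_abs CARD('a) (Y n))"
      by (intro exI allI impI rat_padic_abs_add prime_card)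
  qed
qed

lemma padic_norm_nonneg: "0 \<le> padic_norm (x ::'a::prime_card padic)"
  using padic_norm_ultrametric[of x "- x"] padic_norm_eq_0[of "0 :: 'a padic"]
  by (simp add: padic_norm_minus)

instantiation padic :: (prime_card) metric_space
begin

definition dist_padic :: "'a padic \<Rightarrow> 'a padic \<Rightarrow> real" where
  "dist_padic x y = padic_norm (x - y)"

definition uniformity_padic :: "('a padic \<times> 'a padic) filter" where
  "uniformity_padic = (INF e\<in>{0 <..}. principal {(x, y). dist x y < e})"

definition open_padic :: "'a padic set \<Rightarrow> bool" where
  "open_padic U \<longleftrightarrow> (\<forall>x\<in>U. \<forall>\<^sub>F (x', y) in uniformity. x' = x \<longrightarrow> y \<in> U)"

instance
proof
  fix x y z :: "'a padic"
  show "dist x y = 0 \<longleftrightarrow> x = y" by (simp add: dist_padic_def padic_norm_eq_0)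
  have "padic_norm (x - y) \<le> max (padic_norm (x - z)) (padic_norm (- (y - z)))"
    using padic_norm_ultrametric[of "x - z" "- (y - z)"] by simp
  thus "dist x y \<le> dist x z + dist y z"
    unfolding dist_padic_def padic_norm_minus
    using padic_norm_nonneg[of "x - z"] padic_norm_nonneg[of "y - z"] by linarith
qed (simp_all add: uniformity_padic_def open_padic_def)

end

lemma padic_norm_mult: "padic_norm (x * y :: 'p::prime_card padic) = padic_norm x * padic_norm y"
proof transfer
  fix X Y assume "padic_rel CARD('p) X X" "padic_rel CARD('p) Y Y"
  hence C: "padic_Cauchy CARD('p) X" "padic_Cauchy CARD('p) Y" by (simp_all add: padic_rel_def)
  have "(\<lambda>n. rat_padic_abs CARD('p) (X n) * rat_padic_abs CARD('p) (Y n))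
     \<longlonglongrightarrow> lim (\<lambda>n. rat_padic_abs CARD('p) (X n)) * lim (\<lambda>n. rat_padic_abs CARD('p) (Y n))"
    by (intro tendsto_mult padic_abs_lim C)
  thus "lim (\<lambda>n. rat_padic_abs CARD('p) (X n * Y n))
     = lim (\<lambda>n. rat_padic_abs CARD('p) (X n)) * lim (\<lambda>n. rat_padic_abs CARD('p) (Y n))"
    unfolding rat_padic_abs_mult[OF prime_card] by (rule limI)
qed

lemma of_nat_padic: "of_nat n = (abs_padic (\<lambda>_. of_nat n) :: 'p::prime_card padic)"
proof (induction n)
  case (Suc n)
  show ?case
    unfolding of_nat_Suc Suc one_padic_def
    by (subst plus_padic.abs_eq) (auto simp: padic_rel_def prime_card)
qed (simp add: zero_padic_def)

lemma padic_norm_of_nat: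
  "padic_norm (of_nat n :: 'p::prime_card padic) = rat_padic_abs CARD('p) (of_nat n)"
  unfolding of_nat_padic by (subst padic_norm.abs_eq) (auto simp: padic_rel_def prime_card limI)

instance padic :: (prime_card) field_char_0
proof
  show "inj (of_nat :: nat \<Rightarrow> 'a padic)"
  proof (rule linorder_injI)
    fix m n :: nat assume "m < n"
    hence "padic_norm (of_nat (n - m) :: 'a padic) \<noteq> 0"
      unfolding padic_norm_of_nat rat_padic_abs_eq_0[OF prime_card] by simp
    hence "(of_nat (n - m) :: 'a padic) \<noteq> 0" unfolding padic_norm_eq_0 .
    moreover have "(of_nat n :: 'a padic) = of_nat m + of_nat (n - m)"
      using \<open>m < n\<close> unfolding of_nat_add[symmetric] by simp
    ultimately show "(of_nat m :: 'a padic) \<noteq> of_nat n" by (metis add_cancel_right_right)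
  qed
qed

lemma padic_norm_of_rat:
  "padic_norm (of_rat q :: 'p::prime_card padic) = rat_padic_abs CARD('p) q"
proof -
  have i: "padic_norm (of_int a :: 'p padic) = rat_padic_abs CARD('p) (of_int a)" for a
    by (cases a rule: int_cases2)
       (simp_all add: padic_norm_of_nat padic_norm_minus rat_padic_abs_minus[OF prime_card])
  obtain a b where q: "q = of_int a / of_int b" "b \<noteq> 0" by (rule rat_as_quotient)
  have "(of_rat q :: 'p padic) * of_int b = of_int a"
    using q by (simp add: of_rat_divide)
  hence "padic_norm (of_rat q :: 'p padic) * rat_padic_abs CARD('p) (of_int b) = rat_padic_abs CARD('p) (of_int a)"
    by (metis padic_norm_mult i)
  moreover have "rat_padic_abs CARD('p) q * rat_padic_abs CARD('p) (of_int b) = rat_padic_abs CARD('p) (of_int a)"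
    using q by (simp flip: rat_padic_abs_mult[OF prime_card])
  moreover have "rat_padic_abs CARD('p) (of_int b) \<noteq> 0" using q by (simp add: prime_card)
  ultimately show ?thesis by (metis mult_right_cancel)
qed

text \<open>Finitely supported maps from exponent vectors to coefficients; the ring structure is that of
  \<open>poly_mapping\<close>.\<close>

type_synonym ('d, 'k) mpolynomial = "('d \<Rightarrow>\<^sub>0 nat) \<Rightarrow>\<^sub>0 'k"

definition mpoly_eval :: "('d::finite, 'k::comm_semiring_1) mpolynomial \<Rightarrow> 'k ^ 'd \<Rightarrow> 'k" where
  "mpoly_eval P s =
     (\<Sum>a\<in>Poly_Mapping.keys P. Poly_Mapping.lookup P a * (\<Prod>j\<in>UNIV. (s $ j) ^ Poly_Mapping.lookup a j))"

text \<open>Linear independence over the coefficient field of the family \<open>G\<close> (not of the set of its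
  members); \<open>Poly_Mapping.single 0 c\<close> is the constant polynomial \<open>c\<close>.\<close>

definition lin_indep_family :: "('i::finite \<Rightarrow> ('d, 'k::field) mpolynomial) \<Rightarrow> bool" where
  "lin_indep_family G \<longleftrightarrow>
     (\<forall>c :: 'i \<Rightarrow> 'k. (\<Sum>i\<in>UNIV. Poly_Mapping.single 0 (c i) * G i) = 0 \<longrightarrow> (\<forall>i. c i = 0))"

definition with_one :: "('m \<Rightarrow> ('d, 'k::field) mpolynomial) \<Rightarrow> 'm option \<Rightarrow> ('d, 'k) mpolynomial" where
  "with_one F = case_option 1 F"

definition pm_values :: "('m::finite \<Rightarrow> ('d::finite, 'k::field) mpolynomial) \<Rightarrow> ('k ^ 'm) set" where
  "pm_values F = (\<Union>s. {(\<chi> i. mpoly_eval (F i) s), - (\<chi> i. mpoly_eval (F i) s)})"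

text \<open>A graph on all of a type is given by its adjacency relation.\<close>

definition Cay :: "'a::ab_group_add set \<Rightarrow> 'a rel" where
  "Cay S = {(x, y). x - y \<in> S}"

lemma irrefl_Cay: "0 \<notin> S \<Longrightarrow> irrefl (Cay S)"
  by (auto simp: Cay_def irrefl_def)

lemma sym_Cay: "(\<And>x. x \<in> S \<Longrightarrow> - x \<in> S) \<Longrightarrow> sym (Cay S)"
  unfolding Cay_def by (rule symI) (metis (mono_tags, lifting) case_prodD case_prodI mem_Collect_eq minus_diff_eq)

definition borel_coloring :: "'a::topological_space rel \<Rightarrow> 'a set set \<Rightarrow> bool" where
  "borel_coloring E P \<longleftrightarrow>
     partition_on UNIV P \<and> P \<subseteq> sets borel \<and> (\<forall>A\<in>P. \<forall>x\<in>A. \<forall>y\<in>A. (x, y) \<notin> E)"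

text \<open>Up to \<open>ordIso\<close> this does not depend on the choice of the minimal \<open>P\<close>, and a minimal \<open>P\<close> exists
  as soon as there is a Borel colouring at all, because cardinals are well-ordered.\<close>

definition borel_chromatic_number :: "'a::topological_space rel \<Rightarrow> 'a set rel" where
  "borel_chromatic_number E =
     |SOME P. borel_coloring E P \<and> (\<forall>Q. borel_coloring E Q \<longrightarrow> |P| \<le>o |Q| )|"

lemma borel_chromatic_number_attained:
  assumes "borel_coloring E P0"
  shows "\<exists>P. borel_coloring E P \<and> borel_chromatic_number E = |P|
           \<and> (\<forall>Q. borel_coloring E Q \<longrightarrow> |P| \<le>o |Q| )"
proof -
  let ?R = "card_of ` {P. borel_coloring E P}"
  have "\<exists>r\<in>?R. \<forall>r'\<in>?R. r \<le>o r'"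
    using assms by (intro exists_minim_Card_order) (auto simp: card_of_Card_order)
  hence "\<exists>P. borel_coloring E P \<and> (\<forall>Q. borel_coloring E Q \<longrightarrow> |P| \<le>o |Q| )" by blast
  from someI_ex[OF this] show ?thesis unfolding borel_chromatic_number_def by blast
qed

lemma borel_coloring_singletons:
  fixes E :: "'a::t1_space rel"
  assumes "irrefl E"
  shows "borel_coloring E (range (\<lambda>x. {x}))"
  using assms unfolding borel_coloring_def partition_on_def irrefl_def
  by (auto simp: disjoint_def)

text \<open>The supremum of the p-adic absolute values of the coordinates; the library's \<open>dist\<close> on
  \<open>'p padic ^ 'm\<close> is instead the Euclidean combination of the coordinate distances.\<close>

definition padic_sup_norm :: "'p::prime_card padic ^ 'm::finite \<Rightarrow> real" where
  "padic_sup_norm v = Max (range (\<lambda>i. padic_norm (v $ i)))"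

end

theory Submission
  imports Defs
begin

text \<open>
  Countably many colours suffice because the vertex space is covered by countably many balls too
  small to contain two adjacent points.

  For the lower bound measurability plays no role. Restricting the \<open>F\<^sub>i\<close> to a monomial curve gives a
  polynomial curve \<open>\<phi> s = a\<^sub>0 + s a\<^sub>1 + \<dots> + s\<^sup>D a\<^sub>D\<close> in the vertex space whose coefficients \<open>a\<^sub>1, \<dots>, a\<^sub>D\<close>
  span it. Fix invariant means \<open>M\<close> on the vertex space and \<open>m\<close> on the field, as discrete abelian
  groups. One colour class \<open>A\<close> of a finite colouring has positive mean. By van der Corput differencing,
  \<open>m\<^sub>s M\<^sub>x f (x + \<phi> s) g x\<close> does not change when \<open>f\<close> is shifted by a multiple of an \<open>a\<^sub>k\<close>,
  \<open>k \<ge> 1\<close>, hence by any vector. Averaging \<open>f\<close> over shifts until it is almost invariant then gives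
  \<open>m\<^sub>s M\<^sub>x 1\<^sub>A (x + \<phi> s) 1\<^sub>A x \<ge> (M 1\<^sub>A)\<^sup>2 > 0\<close>. The \<open>s\<close> for which \<open>\<phi> s\<close> lies in the excluded
  ball form a bounded set, which is \<open>m\<close>-null; so some \<open>\<phi> s\<close> outside the ball is a difference of two
  points of \<open>A\<close>.
\<close>

subsection \<open>Bounded functions\<close>

definition bfun :: "('a \<Rightarrow> real) \<Rightarrow> bool" where
  "bfun f \<longleftrightarrow> (\<exists>C. \<forall>x. \<bar>f x\<bar> \<le> C)"

lemma bfunI: "(\<And>x. \<bar>f x\<bar> \<le> C) \<Longrightarrow> bfun f"
  unfolding bfun_def by blast

lemma bfunD:
  assumes "bfun f"
  shows "\<exists>C>0. \<forall>x. \<bar>f x\<bar> \<le> C"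
proof -
  obtain C where C: "\<And>x. \<bar>f x\<bar> \<le> C"
    using assms unfolding bfun_def by blast
  show ?thesis
    by (rule exI[of _ "max C 1"]) (use C in \<open>auto simp: le_max_iff_disj\<close>)
qed

named_theorems bfun_intros

lemma bfun_const [bfun_intros]: "bfun (\<lambda>_. c)"
  by (rule bfunI[of _ "\<bar>c\<bar>"]) simp

lemma bfun_shift [bfun_intros]: "bfun f \<Longrightarrow> bfun (\<lambda>x. f (x + v))"
  unfolding bfun_def by blast

lemma bfun_add [bfun_intros]:
  assumes "bfun f" "bfun g"
  shows "bfun (\<lambda>x. f x + g x)"
proof -
  obtain C D where "\<forall>x. \<bar>f x\<bar> \<le> C" "\<forall>x. \<bar>g x\<bar> \<le> D"
    using assms unfolding bfun_def by blast
  thus ?thesis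
    by (intro bfunI[of _ "C + D"] order_trans[OF abs_triangle_ineq add_mono]) auto
qed

lemma bfun_mult [bfun_intros]:
  assumes "bfun f" "bfun g"
  shows "bfun (\<lambda>x. f x * g x)"
proof -
  obtain C D where "C > 0" "\<forall>x. \<bar>f x\<bar> \<le> C" "\<forall>x. \<bar>g x\<bar> \<le> D"
    using assms bfunD[OF assms(1)] unfolding bfun_def by blast
  thus ?thesis
    by (intro bfunI[of _ "C * D"]) (auto simp: abs_mult intro!: mult_mono)
qed

lemma bfun_minus [bfun_intros]: "bfun f \<Longrightarrow> bfun (\<lambda>x. - f x)"
  unfolding bfun_def by simp

lemma bfun_diff [bfun_intros]: "bfun f \<Longrightarrow> bfun g \<Longrightarrow> bfun (\<lambda>x. f x - g x)"
  using bfun_add[OF _ bfun_minus, of f g] by simp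

lemma bfun_divide [bfun_intros]: "bfun f \<Longrightarrow> bfun (\<lambda>x. f x / c)"
  using bfun_mult[OF _ bfun_const, of f "inverse c"] by (simp add: divide_inverse)

lemma bfun_power [bfun_intros]: "bfun f \<Longrightarrow> bfun (\<lambda>x. f x ^ n)"
  by (induction n) (auto intro: bfun_intros)

lemma bfun_sum [bfun_intros]: "(\<And>i. i \<in> I \<Longrightarrow> bfun (f i)) \<Longrightarrow> bfun (\<lambda>x. \<Sum>i\<in>I. f i x)"
  by (induction I rule: infinite_finite_induct) (auto intro: bfun_intros)

lemma bfun_indicat [bfun_intros]: "bfun (indicat_real A)"
  by (rule bfunI[of _ 1]) (simp add: indicator_def)

subsection \<open>Invariant means on abelian groups\<close>

text \<open>Zorn's lemma for the reversed order on the proper filters below \<open>F\<close>. A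
  minimal proper filter is an ultrafilter.\<close>

lemma minimal_filter_exists:
  fixes F :: "'a filter"
  assumes "F \<noteq> bot"
  obtains U where "U \<le> F" "U \<noteq> bot" "\<And>G. G \<le> U \<Longrightarrow> G \<noteq> bot \<Longrightarrow> G = U"
proof -
  define A where "A = {G. G \<le> F \<and> G \<noteq> bot}"
  have "\<exists>m\<in>A. \<forall>a\<in>A. m \<ge> a \<longrightarrow> a = m"
  proof (rule predicate_Zorn)
    show "partial_order_on A (relation_of (\<ge>) A)"
      by (auto simp: partial_order_on_def preorder_on_def refl_on_def trans_def antisym_def
          relation_of_def)
    fix C assume C: "C \<in> Chains (relation_of (\<ge>) A)"
    hence sub: "C \<subseteq> A" and tot: "\<And>a b. a \<in> C \<Longrightarrow> b \<in> C \<Longrightarrow> a \<ge> b \<or> b \<ge> a"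
      by (auto simp: Chains_def relation_of_def)
    show "\<exists>u\<in>A. \<forall>a\<in>C. a \<ge> u"
    proof (cases "C = {}")
      case True
      thus ?thesis using assms by (auto simp: A_def)
    next
      case False
      \<comment> \<open>A finite nonempty part of a chain contains its infimum, so all finite infima
        are proper; this yields properness of \<open>Inf C\<close>.\<close>
      have fin: "X = {} \<or> Inf X \<in> X" if "finite X" "X \<subseteq> C" for X
        using that
      proof (induction X rule: finite_induct)
        case (insert x X)
        show ?case
        proof (cases "X = {}")
          case False
          hence "Inf X \<in> X" using insert by auto
          hence "x \<ge> Inf X \<or> Inf X \<ge> x" using insert tot by auto
          thus ?thesis using \<open>Inf X \<in> X\<close> by (auto simp: inf_absorb1 inf_absorb2)
        qed auto
      qed auto
      have "(top_class.top :: 'a filter) \<noteq> bot"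
        using assms by (metis bot.extremum_uniqueI top_greatest)
      hence "Inf X \<noteq> bot" if "finite X" "X \<subseteq> C" for X
        using fin[OF that] sub that(2) by (auto simp: A_def)
      hence "Inf C \<noteq> bot"
        by (rule Inf_filter_not_bot)
      moreover obtain a where "a \<in> C" using False by blast
      hence "Inf C \<le> F"
        using sub Inf_lower[of a C] by (auto simp: A_def intro: order_trans)
      ultimately show ?thesis by (intro bexI[of _ "Inf C"]) (auto simp: A_def Inf_lower)
    qed
  qed
  then obtain U where U: "U \<le> F" "U \<noteq> bot" and min: "\<And>G. G \<in> A \<Longrightarrow> G \<le> U \<Longrightarrow> G = U"
    unfolding A_def by blast
  show ?thesis
  proof (rule that[OF U])
    show "G = U" if "G \<le> U" "G \<noteq> bot" for G
      using that U by (intro min) (auto simp: A_def)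
  qed
qed

text \<open>By compactness of \<open>{-C..C}\<close> the image filter has a cluster point
  \<open>x\<close>. Refining \<open>U\<close> so that \<open>u\<close> tends to \<open>x\<close>
  leaves a proper filter, which is \<open>U\<close> itself by minimality.\<close>

lemma minimal_filter_convergent:
  assumes U: "U \<noteq> bot" "\<And>G. G \<le> U \<Longrightarrow> G \<noteq> bot \<Longrightarrow> G = U"
    and u: "\<And>i. \<bar>u i\<bar> \<le> (C :: real)"
  shows "\<exists>l. (u \<longlongrightarrow> l) U"
proof -
  have "\<exists>x\<in>{-C..C}. inf (nhds x) (filtermap u U) \<noteq> bot"
    using compact_Icc[of "-C" C] U(1) u unfolding compact_filter
    by (auto simp: eventually_filtermap filtermap_bot_iff abs_le_iff minus_le_iff)
  then obtain x where x: "inf (nhds x) (filtermap u U) \<noteq> bot" by blast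
  define G where "G = inf U (filtercomap u (nhds x))"
  have "G \<noteq> bot"
  proof
    assume "G = bot"
    then obtain P Q where "eventually P U" and Q: "eventually Q (nhds x)"
      and PQ: "\<And>i. P i \<Longrightarrow> \<not> Q (u i)"
      unfolding G_def trivial_limit_def eventually_inf eventually_filtercomap by metis
    hence "eventually (\<lambda>y. \<not> Q y) (filtermap u U)"
      by (auto simp: eventually_filtermap elim: eventually_mono)
    hence "eventually (\<lambda>_. False) (inf (nhds x) (filtermap u U))"
      using Q unfolding eventually_inf by blast
    thus False using x by (simp add: trivial_limit_def)
  qed
  hence "G = U" using U(2)[of G] by (simp add: G_def)
  hence "U \<le> filtercomap u (nhds x)" unfolding G_def by (metis inf.cobounded2)
  thus ?thesis by (metis filterlim_def filtermap_le_iff_le_filtercomap)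
qed

text \<open>A translation-invariant finitely additive probability on a discrete group, seen as a
  functional. As a HOL function \<open>M\<close> is total; the axioms constrain it on bounded
  functions.\<close>

locale invariant_mean =
  fixes M :: "('a::ab_group_add \<Rightarrow> real) \<Rightarrow> real"
  assumes mean_add: "bfun f \<Longrightarrow> bfun g \<Longrightarrow> M (\<lambda>x. f x + g x) = M f + M g"
    and mean_scale: "bfun f \<Longrightarrow> M (\<lambda>x. c * f x) = c * M f"
    and mean_nonneg: "bfun f \<Longrightarrow> (\<And>x. 0 \<le> f x) \<Longrightarrow> 0 \<le> M f"
    and mean_one: "M (\<lambda>_. 1) = 1"
    and mean_shift: "bfun f \<Longrightarrow> M (\<lambda>x. f (x + v)) = M f"

text \<open>The average over \<open>0 \<le> n\<^sub>j < L\<close> of \<open>f (x + n\<^sub>1 v\<^sub>1 + n\<^sub>2 v\<^sub>2 + \<dots>)\<close>; such boxes are Folner sets.\<close>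

fun box_avg :: "nat \<Rightarrow> 'a::ab_group_add list \<Rightarrow> ('a \<Rightarrow> real) \<Rightarrow> 'a \<Rightarrow> real" where
  "box_avg L [] f = f"
| "box_avg L (v # vs) f = box_avg L vs (\<lambda>x. (\<Sum>i<L. f (x + (\<Sum>j<i. v))) / real L)"

lemma box_avg_add: "box_avg L vs (\<lambda>x. f x + g x) x = box_avg L vs f x + box_avg L vs g x"
  by (induction vs arbitrary: f g) (simp_all add: sum.distrib add_divide_distrib)

lemma box_avg_scale: "box_avg L vs (\<lambda>x. c * f x) x = c * box_avg L vs f x"
proof (induction vs arbitrary: f)
  case (Cons v vs)
  show ?case by (simp add: Cons.IH[symmetric] sum_distrib_left)
qed simp

lemma box_avg_nonneg: "(\<And>x. 0 \<le> f x) \<Longrightarrow> 0 \<le> box_avg L vs f x"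
  by (induction vs arbitrary: f) (simp_all add: sum_nonneg)

lemma box_avg_one: "L > 0 \<Longrightarrow> box_avg L vs (\<lambda>_. 1) x = 1"
  by (induction vs) simp_all

lemma box_avg_le:
  assumes "L > 0" "\<And>x. f x \<le> C" shows "box_avg L vs f x \<le> C"
proof -
  have "0 \<le> box_avg L vs (\<lambda>x. C * 1 + (-1) * f x) x"
    using assms by (intro box_avg_nonneg) simp
  also have "\<dots> = C - box_avg L vs f x"
    unfolding box_avg_add box_avg_scale box_avg_one[OF assms(1)] by simp
  finally show ?thesis by simp
qed

lemma box_avg_abs_le:
  assumes "L > 0" "\<And>x. \<bar>f x\<bar> \<le> C" shows "\<bar>box_avg L vs f x\<bar> \<le> C"
proof -
  have "box_avg L vs f x \<le> C"
    by (rule box_avg_le[OF assms(1)]) (use assms(2) in \<open>simp add: abs_le_iff\<close>)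
  moreover have "box_avg L vs (\<lambda>x. (-1) * f x) x \<le> C"
    by (rule box_avg_le[OF assms(1)]) (use assms(2) in \<open>simp add: abs_le_iff\<close>)
  ultimately show ?thesis unfolding box_avg_scale by simp
qed

text \<open>In direction \<open>v\<close> the average telescopes to two boundary values divided by
  \<open>L\<close>; averaging in the other directions keeps the bound.\<close>

lemma box_avg_shift:
  assumes "L > 0" "\<And>x. \<bar>f x\<bar> \<le> C" "v \<in> set vs"
  shows "\<bar>box_avg L vs (\<lambda>x. f (x + v) - f x) x\<bar> \<le> 2 * C / L"
  using assms(2,3)
proof (induction vs arbitrary: f)
  case (Cons w ws)
  define g where "g = (\<lambda>x. (\<Sum>i<L. f (x + (\<Sum>j<i. w))) / real L)"
  show ?case
  proof (cases "v = w")
    case True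
    have "(\<Sum>i<L. f (x + (\<Sum>j<i. w) + v) - f (x + (\<Sum>j<i. w))) / real L
      = (f (x + (\<Sum>j<L. w)) - f x) / real L" for x
      using sum_lessThan_telescope[of "\<lambda>i. f (x + (\<Sum>j<i. w))" L] True by (simp add: add.assoc)
    hence "box_avg L (w # ws) (\<lambda>x. f (x + v) - f x) x
        = box_avg L ws (\<lambda>x. (f (x + (\<Sum>j<L. w)) - f x) / real L) x"
      by (simp only: box_avg.simps add.assoc add.commute[of v])
    moreover have "\<bar>(f (x + (\<Sum>j<L. w)) - f x) / real L\<bar> \<le> 2 * C / L" for x
      using Cons.prems(1)[of x] Cons.prems(1)[of "x + (\<Sum>j<L. w)"] assms(1)
      by (simp add: divide_right_mono)
    ultimately show ?thesis by (auto intro!: box_avg_abs_le assms(1))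
  next
    case False
    have "\<bar>g x\<bar> \<le> C" for x
    proof -
      have "\<bar>\<Sum>i<L. f (x + (\<Sum>j<i. w))\<bar> \<le> real (card {..<L}) * C"
        by (intro order_trans[OF sum_abs] sum_bounded_above Cons.prems(1))
      thus ?thesis using assms(1) by (simp add: g_def field_simps)
    qed
    hence "\<bar>box_avg L ws (\<lambda>x. g (x + v) - g x) x\<bar> \<le> 2 * C / L"
      using False Cons.prems(2) by (intro Cons.IH) auto
    moreover have "(\<lambda>x. g (x + v) - g x)
        = (\<lambda>x. (\<Sum>i<L. f (x + (\<Sum>j<i. w) + v) - f (x + (\<Sum>j<i. w))) / real L)"
      by (simp add: g_def sum_subtractf diff_divide_distrib add_ac)
    ultimately show ?thesis by (simp add: add_ac)
  qed
qed simp

text \<open>The mean is the limit of box averages along an ultrafilter on pairs of a finite set of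
  directions and a side length. A fixed \<open>v\<close> is eventually among the directions, and
  then the shift error is O(1/L).\<close>

lemma invariant_mean_exists: "\<exists>M :: ('a::ab_group_add \<Rightarrow> real) \<Rightarrow> real. invariant_mean M"
proof -
  define F where "F = finite_subsets_at_top (UNIV :: 'a set) \<times>\<^sub>F sequentially"
  have "F \<noteq> bot" by (simp add: F_def prod_filter_eq_bot)
  then obtain U where UF: "U \<le> F" and U: "U \<noteq> bot" "\<And>G. G \<le> U \<Longrightarrow> G \<noteq> bot \<Longrightarrow> G = U"
    using minimal_filter_exists by metis
  have U': "\<not> trivial_limit U" using U(1) .
  \<comment> \<open>\<open>Suc\<close> keeps the side length positive. A list \<open>vs\<close>
    exists once \<open>fst i\<close> is finite, which holds eventually along
    \<open>F\<close>.\<close>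
  define b :: "('a \<Rightarrow> real) \<Rightarrow> 'a set \<times> nat \<Rightarrow> real" where
    "b f i = box_avg (Suc (snd i)) (SOME vs. set vs = fst i) f 0" for f i
  define M where "M f = Lim U (b f)" for f
  have conv: "(b f \<longlongrightarrow> M f) U" if f: "bfun f" for f
  proof -
    obtain C where "C > 0" "\<And>x. \<bar>f x\<bar> \<le> C" using bfunD[OF f] by blast
    hence "\<And>i. \<bar>b f i\<bar> \<le> C" unfolding b_def by (intro box_avg_abs_le) simp_all
    with minimal_filter_convergent[OF U, of "b f" C] obtain l where "(b f \<longlongrightarrow> l) U" by blast
    thus ?thesis using tendsto_Lim[OF U'] unfolding M_def by metis
  qed
  have MI: "M f = l" if "bfun f" "(b f \<longlongrightarrow> l) U" for f l
    using tendsto_unique[OF U' conv] that by blast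
  have add: "M (\<lambda>x. f x + g x) = M f + M g" if "bfun f" "bfun g" for f g
  proof (rule MI)
    have "b (\<lambda>x. f x + g x) = (\<lambda>i. b f i + b g i)" by (simp add: b_def box_avg_add fun_eq_iff)
    thus "(b (\<lambda>x. f x + g x) \<longlongrightarrow> M f + M g) U"
      using tendsto_add[OF conv conv] that by simp
  qed (intro bfun_intros that)
  have scale: "M (\<lambda>x. c * f x) = c * M f" if "bfun f" for c f
  proof (rule MI)
    have "b (\<lambda>x. c * f x) = (\<lambda>i. c * b f i)" by (simp add: b_def box_avg_scale fun_eq_iff)
    thus "(b (\<lambda>x. c * f x) \<longlongrightarrow> c * M f) U"
      using tendsto_mult[OF tendsto_const conv] that by simp
  qed (intro bfun_intros that)
  have shift0: "M (\<lambda>x. f (x + v) - f x) = 0" if f: "bfun f" for f v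
  proof (rule MI)
    obtain C where C: "C > 0" "\<And>x. \<bar>f x\<bar> \<le> C" using bfunD[OF f] by blast
    have "eventually (\<lambda>i. v \<in> fst i \<and> finite (fst i)) F"
      unfolding F_def eventually_prod_filter
      by (intro exI[of _ "\<lambda>E. v \<in> E \<and> finite E"] exI[of _ "\<lambda>_. True"])
         (auto simp: eventually_finite_subsets_at_top intro!: exI[of _ "{v}"])
    hence ev: "eventually (\<lambda>i. norm (b (\<lambda>x. f (x + v) - f x) i) \<le> 2 * C / Suc (snd i)) F"
    proof eventually_elim
      case (elim i)
      have "set (SOME vs. set vs = fst i) = fst i"
        using elim finite_list[of "fst i"] by (metis (mono_tags, lifting) someI_ex)
      thus ?case using elim unfolding b_def real_norm_def
        by (intro box_avg_shift C(2)) auto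
    qed
    have "((\<lambda>i. 2 * C * inverse (real (Suc (snd i)))) \<longlongrightarrow> 0) F"
      unfolding F_def
      by (rule filterlim_compose[OF tendsto_mult_right_zero[OF LIMSEQ_inverse_real_of_nat] filterlim_snd])
    hence "((\<lambda>i. 2 * C / real (Suc (snd i))) \<longlongrightarrow> 0) F"
      by (simp only: divide_inverse)
    hence "(b (\<lambda>x. f (x + v) - f x) \<longlongrightarrow> 0) F"
      by (rule Lim_null_comparison[OF ev])
    thus "(b (\<lambda>x. f (x + v) - f x) \<longlongrightarrow> 0) U"
      by (rule tendsto_mono[OF UF])
  qed (intro bfun_intros that)
  have "invariant_mean M"
  proof
    show "0 \<le> M f" if "bfun f" "\<And>x. 0 \<le> f x" for f
      using that by (intro tendsto_lowerbound[OF conv _ U'])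
        (auto intro!: always_eventually simp: b_def box_avg_nonneg)
    have "b (\<lambda>_. 1) = (\<lambda>_. 1)" by (simp add: b_def box_avg_one fun_eq_iff)
    thus "M (\<lambda>_. 1) = 1" by (intro MI bfun_intros) simp
    show "M (\<lambda>x. f (x + v)) = M f" if "bfun f" for f v
      using shift0[OF that, of v] add[OF bfun_diff[OF bfun_shift[OF that] that] that, of v] by simp
  qed (use add scale in auto)
  thus ?thesis by blast
qed

section \<open>The Cauchy-Schwarz inequality for means\<close>

lemma discriminant_le:
  fixes a b c :: real
  assumes a: "0 \<le> a" and le: "\<And>t. 0 \<le> t\<^sup>2 * a + 2 * t * b + c"
  shows "b\<^sup>2 \<le> a * c"
proof (cases "a = 0")
  case True
  have "b = 0"
  proof (rule ccontr)
    assume b: "b \<noteq> 0"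
    have "2 * (- (c + 1) / (2 * b)) * b + c = -1" using b by (simp add: field_simps)
    thus False using le[of "- (c + 1) / (2 * b)"] True by simp
  qed
  thus ?thesis using True by simp
next
  case False
  hence "(b / a)\<^sup>2 * a + 2 * (- b / a) * b = - (b\<^sup>2 / a)"
    by (simp add: field_simps power2_eq_square)
  hence "b\<^sup>2 / a \<le> c" using le[of "- b / a"] by simp
  thus ?thesis using False a by (simp add: field_simps)
qed

context invariant_mean
begin

lemma mean_diff: "bfun f \<Longrightarrow> bfun g \<Longrightarrow> M (\<lambda>x. f x - g x) = M f - M g"
  using mean_add[of f "\<lambda>x. (-1) * g x"] mean_scale[of g "-1"] by (simp add: bfun_intros)

lemma mean_const: "M (\<lambda>_. c) = c"
  using mean_scale[of "\<lambda>_. 1" c] mean_one by (simp add: bfun_intros)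

lemma mean_sum: "(\<And>i. i \<in> I \<Longrightarrow> bfun (f i)) \<Longrightarrow> M (\<lambda>x. \<Sum>i\<in>I. f i x) = (\<Sum>i\<in>I. M (f i))"
  by (induction I rule: infinite_finite_induct) (simp_all add: mean_const mean_add bfun_intros)

lemma mean_mono:
  assumes "bfun f" "bfun g" "\<And>x. f x \<le> g x"
  shows "M f \<le> M g"
  using mean_nonneg[of "\<lambda>x. g x - f x"] assms by (simp add: mean_diff bfun_intros)

lemma mean_abs_le:
  assumes "\<And>x. \<bar>f x\<bar> \<le> C"
  shows "\<bar>M f\<bar> \<le> C"
proof -
  have f: "bfun f" by (rule bfunI[OF assms])
  have "M f \<le> C"
    using mean_mono[OF f bfun_const, of C] assms by (simp add: mean_const abs_le_iff)
  moreover have "-C \<le> M f"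
    using mean_mono[OF bfun_const f, of "-C"] assms by (simp add: mean_const abs_le_iff minus_le_iff)
  ultimately show ?thesis by simp
qed

lemma mean_cauchy_schwarz:
  assumes "bfun f" "bfun g"
  shows "(M (\<lambda>x. f x * g x))\<^sup>2 \<le> M (\<lambda>x. (f x)\<^sup>2) * M (\<lambda>x. (g x)\<^sup>2)"
proof (rule discriminant_le)
  show "0 \<le> M (\<lambda>x. (f x)\<^sup>2)"
    using assms by (intro mean_nonneg bfun_intros) simp_all
  fix t :: real
  have "0 \<le> M (\<lambda>x. (t * f x + g x)\<^sup>2)"
    using assms by (intro mean_nonneg bfun_intros) simp_all
  also have "(\<lambda>x. (t * f x + g x)\<^sup>2) = (\<lambda>x. t\<^sup>2 * (f x)\<^sup>2 + 2 * t * (f x * g x) + (g x)\<^sup>2)"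
    by (simp add: power2_eq_square algebra_simps)
  also have "M \<dots> = t\<^sup>2 * M (\<lambda>x. (f x)\<^sup>2) + 2 * t * M (\<lambda>x. f x * g x) + M (\<lambda>x. (g x)\<^sup>2)"
    by (simp only: mean_add mean_scale bfun_intros assms)
  finally show "0 \<le> t\<^sup>2 * M (\<lambda>x. (f x)\<^sup>2) + 2 * t * M (\<lambda>x. f x * g x) + M (\<lambda>x. (g x)\<^sup>2)" .
qed

lemma mean_cauchy_schwarz_le:
  assumes "bfun f" "bfun g" "M (\<lambda>x. (f x)\<^sup>2) \<le> \<eta>\<^sup>2" "M (\<lambda>x. (g x)\<^sup>2) \<le> \<kappa>\<^sup>2" "0 \<le> \<eta>" "0 \<le> \<kappa>"
  shows "\<bar>M (\<lambda>x. f x * g x)\<bar> \<le> \<eta> * \<kappa>"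
proof -
  have "(M (\<lambda>x. f x * g x))\<^sup>2 \<le> M (\<lambda>x. (f x)\<^sup>2) * M (\<lambda>x. (g x)\<^sup>2)"
    by (rule mean_cauchy_schwarz[OF assms(1,2)])
  also have "\<dots> \<le> \<eta>\<^sup>2 * \<kappa>\<^sup>2"
    using assms by (intro mult_mono mean_nonneg bfun_intros) simp_all
  finally have "(M (\<lambda>x. f x * g x))\<^sup>2 \<le> (\<eta> * \<kappa>)\<^sup>2" by (simp add: power_mult_distrib)
  thus ?thesis using assms(5,6) by (simp add: abs_le_square_iff[symmetric])
qed

lemma mean_square_le: "bfun f \<Longrightarrow> (M f)\<^sup>2 \<le> M (\<lambda>x. (f x)\<^sup>2)"
  using mean_cauchy_schwarz[of f "\<lambda>_. 1"] by (simp add: mean_const bfun_intros)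

end

text \<open>A dyadic convex hull of the \<open>H\<close>-orbit of \<open>f\<close>. Midpoints
  suffice for the parallelogram law, and rule induction transports every property stable under
  shifts and midpoints.\<close>

inductive_set conv_orbit :: "'a::ab_group_add set \<Rightarrow> ('a \<Rightarrow> real) \<Rightarrow> ('a \<Rightarrow> real) set"
  for H :: "'a set" and f :: "'a \<Rightarrow> real" where
  base: "f \<in> conv_orbit H f"
| shift: "h \<in> conv_orbit H f \<Longrightarrow> u \<in> H \<Longrightarrow> (\<lambda>x. h (x + u)) \<in> conv_orbit H f"
| mid: "h \<in> conv_orbit H f \<Longrightarrow> h' \<in> conv_orbit H f \<Longrightarrow> (\<lambda>x. (h x + h' x) / 2) \<in> conv_orbit H f"

lemma bfun_conv_orbit: "h \<in> conv_orbit H f \<Longrightarrow> bfun f \<Longrightarrow> bfun h"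
  by (induction rule: conv_orbit.induct) (auto intro: bfun_intros)

context invariant_mean
begin

lemma mean_mid: "bfun f \<Longrightarrow> bfun g \<Longrightarrow> M (\<lambda>x. (f x + g x) / 2) = (M f + M g) / 2"
  using mean_scale[of "\<lambda>x. f x + g x" "1/2"] by (simp add: mean_add bfun_intros)

lemma mean_conv_orbit: "h \<in> conv_orbit H f \<Longrightarrow> bfun f \<Longrightarrow> M h = M f"
  by (induction rule: conv_orbit.induct) (auto simp: mean_shift mean_mid bfun_conv_orbit)

text \<open>An element of almost minimal norm in a convex set closed under shifts is almost invariant,
  by the parallelogram law.\<close>

lemma almost_invariant_exists:
  assumes f: "bfun f" and \<eta>: "\<eta> > 0"
  obtains h where "h \<in> conv_orbit H f" "\<And>u. u \<in> H \<Longrightarrow> M (\<lambda>x. (h (x + u) - h x)\<^sup>2) \<le> \<eta>\<^sup>2"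
proof -
  define N where "N h = M (\<lambda>x. (h x)\<^sup>2)" for h
  define I where "I = Inf (N ` conv_orbit H f)"
  have nonneg: "0 \<le> N h" if "h \<in> conv_orbit H f" for h
    unfolding N_def by (intro mean_nonneg bfun_intros bfun_conv_orbit[OF that f]) simp
  have bdd: "bdd_below (N ` conv_orbit H f)"
    using nonneg by (auto intro!: bdd_belowI[of _ 0])
  have I: "I \<le> N h" if "h \<in> conv_orbit H f" for h
    unfolding I_def using that by (intro cInf_lower bdd) auto
  \<comment> \<open>The slack is a quarter of \<open>\<eta>\<^sup>2\<close> because the
    parallelogram law multiplies it by 4.\<close>
  have "\<exists>y\<in>N ` conv_orbit H f. y < I + \<eta>\<^sup>2 / 4"
    unfolding I_def using \<eta> conv_orbit.base by (intro cInf_lessD) auto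
  then obtain h where h: "h \<in> conv_orbit H f" "N h < I + \<eta>\<^sup>2 / 4" by blast
  note bh = bfun_conv_orbit[OF h(1) f]
  have "M (\<lambda>x. (h (x + u) - h x)\<^sup>2) \<le> \<eta>\<^sup>2" if u: "u \<in> H" for u
  proof -
    have mem: "(\<lambda>x. (h (x + u) + h x) / 2) \<in> conv_orbit H f"
      using h(1) u by (intro conv_orbit.intros)
    have sq: "(a - b)\<^sup>2 = 2 * a\<^sup>2 + 2 * b\<^sup>2 - 4 * ((a + b) / 2)\<^sup>2" for a b :: real
      by (simp add: power2_eq_square algebra_simps)
    have "M (\<lambda>x. (h (x + u) - h x)\<^sup>2)
        = 2 * M (\<lambda>x. (h (x + u))\<^sup>2) + 2 * N h - 4 * N (\<lambda>x. (h (x + u) + h x) / 2)"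
      unfolding sq N_def using bh by (simp add: mean_add mean_diff mean_scale bfun_intros)
    also have "M (\<lambda>x. (h (x + u))\<^sup>2) = N h"
      unfolding N_def using bh by (intro mean_shift[where f = "\<lambda>x. (h x)\<^sup>2"] bfun_intros)
    finally show ?thesis using I[OF mem] h(2) by simp
  qed
  thus ?thesis using that h(1) by blast
qed

end

subsection \<open>Correlations along a curve\<close>

locale two_means = M: invariant_mean M + m: invariant_mean m
  for M :: "('g::ab_group_add \<Rightarrow> real) \<Rightarrow> real" and m :: "('k::field_char_0 \<Rightarrow> real) \<Rightarrow> real"
begin

text \<open>If \<open>f\<close> and \<open>g\<close> are both the indicator of a set, only those
  \<open>s\<close> contribute for which \<open>\<phi> s\<close> is a difference of two of its
  points.\<close>

definition corr :: "('k \<Rightarrow> 'g) \<Rightarrow> ('g \<Rightarrow> real) \<Rightarrow> ('g \<Rightarrow> real) \<Rightarrow> real" where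
  "corr \<phi> f g = m (\<lambda>s. M (\<lambda>x. f (x + \<phi> s) * g x))"

lemma bfun_corr:
  assumes "bfun f" "bfun g" shows "bfun (\<lambda>s. M (\<lambda>x. f (x + a s) * g (x + b s)))"
proof -
  obtain C D where CD: "C > 0" "\<forall>x. \<bar>f x\<bar> \<le> C" "\<forall>x. \<bar>g x\<bar> \<le> D"
    using bfunD[OF assms(1)] bfunD[OF assms(2)] by blast
  show ?thesis
    by (rule bfunI[of _ "C * D"], rule M.mean_abs_le)
       (use CD in \<open>auto simp: abs_mult intro!: mult_mono\<close>)
qed

lemma bfun_corr0: "bfun f \<Longrightarrow> bfun g \<Longrightarrow> bfun (\<lambda>s. M (\<lambda>x. f (x + a s) * g x))"
  using bfun_corr[of f g a "\<lambda>_. 0"] by simp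

text \<open>Replacing the shift of \<open>f\<close> by \<open>\<phi> s\<close> with its average over \<open>\<phi> (s + i)\<close>, \<open>i < n\<close>, does not
  change \<open>corr \<phi> f g\<close>; in the square norm of that average only the \<open>n\<close> diagonal terms survive.\<close>

lemma van_der_corput:
  assumes f: "bfun f" and g: "bfun g"
    and null: "\<And>h. h \<noteq> 0 \<Longrightarrow> corr (\<lambda>s. \<phi> (s + h) - \<phi> s) f f = 0"
  shows "corr \<phi> f g = 0"
proof (rule ccontr)
  assume nz: "corr \<phi> f g \<noteq> 0"
  let ?T = "corr \<phi> f g"
  define A where "A = M (\<lambda>x. (g x)\<^sup>2)"
  define B where "B = M (\<lambda>x. f x * f x)"
  have AB: "0 \<le> A" "0 \<le> B"
    unfolding A_def B_def using f g by (auto intro!: M.mean_nonneg bfun_intros)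
  \<comment> \<open>The square of \<open>n T\<close> is at most \<open>A\<close> times the
    \<open>n\<close> diagonal terms \<open>B\<close>. The resulting bound is linear in
    \<open>n\<close> on the left only, which forces \<open>T = 0\<close>.\<close>
  have bound: "real n * ?T\<^sup>2 \<le> A * B" if n: "n > 0" for n :: nat
  proof -
    define c where "c s x = (\<Sum>i<n. f (x + \<phi> (s + of_nat i)))" for s x
    have bc: "bfun (c s)" for s unfolding c_def using f by (intro bfun_intros)
    have eachT: "m (\<lambda>s. M (\<lambda>x. f (x + \<phi> (s + h)) * g x)) = ?T" for h
      unfolding corr_def
      by (rule m.mean_shift[where f = "\<lambda>s. M (\<lambda>x. f (x + \<phi> s) * g x)"]) (intro bfun_corr0 f g)
    have cg: "M (\<lambda>x. c s x * g x) = (\<Sum>i<n. M (\<lambda>x. f (x + \<phi> (s + of_nat i)) * g x))" for s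
      unfolding c_def sum_distrib_right using f g by (intro M.mean_sum bfun_intros)
    have "m (\<lambda>s. (\<Sum>i<n. M (\<lambda>x. f (x + \<phi> (s + of_nat i)) * g x))) = real n * ?T"
      using f g by (subst m.mean_sum) (auto intro!: bfun_corr0 simp: eachT)
    hence nT: "real n * ?T = m (\<lambda>s. M (\<lambda>x. c s x * g x))" by (simp only: cg)
    have bcg: "bfun (\<lambda>s. M (\<lambda>x. c s x * g x))"
      unfolding cg using f g by (intro bfun_intros bfun_corr0)
    have cc: "M (\<lambda>x. (c s x)\<^sup>2)
        = (\<Sum>i<n. \<Sum>j<n. M (\<lambda>x. f (x + \<phi> (s + of_nat i)) * f (x + \<phi> (s + of_nat j))))" for s
      unfolding power2_eq_square c_def sum_product
      using f by (subst M.mean_sum, intro bfun_intros, assumption+)+ simp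
    have bcc: "bfun (\<lambda>s. M (\<lambda>x. (c s x)\<^sup>2))"
      unfolding cc using f by (intro bfun_intros bfun_corr)
    have pair: "m (\<lambda>s. M (\<lambda>x. f (x + \<phi> (s + of_nat i)) * f (x + \<phi> (s + of_nat j))))
        = (if i = j then B else 0)" for i j :: nat
    proof -
      have "M (\<lambda>x. f (x + \<phi> (s + of_nat i)) * f (x + \<phi> (s + of_nat j)))
          = M (\<lambda>x. f (x + (\<phi> (s + of_nat i) - \<phi> (s + of_nat j))) * f x)" for s
        using M.mean_shift[of "\<lambda>x. f (x + \<phi> (s + of_nat i)) * f (x + \<phi> (s + of_nat j))"
            "- \<phi> (s + of_nat j)"] f by (simp add: bfun_intros algebra_simps)
      hence eq: "m (\<lambda>s. M (\<lambda>x. f (x + \<phi> (s + of_nat i)) * f (x + \<phi> (s + of_nat j))))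
          = corr (\<lambda>s. \<phi> (s + of_nat i) - \<phi> (s + of_nat j)) f f"
        by (simp add: corr_def)
      show ?thesis
      proof (cases "i = j")
        case True
        thus ?thesis unfolding eq by (simp add: corr_def B_def m.mean_const)
      next
        case False
        \<comment> \<open>Substituting \<open>s - j\<close> for \<open>s\<close> brings the pair
          into the form of the hypothesis with \<open>h = i - j\<close>, which is nonzero in
          characteristic 0.\<close>
        have "corr (\<lambda>s. \<phi> (s + of_nat i) - \<phi> (s + of_nat j)) f f
            = corr (\<lambda>s. \<phi> (s + (of_nat i - of_nat j)) - \<phi> s) f f"
          unfolding corr_def
          using m.mean_shift[OF bfun_corr0[OF f f], of "\<lambda>s. \<phi> (s + (of_nat i - of_nat j)) - \<phi> s" "of_nat j"]
          by (simp add: add.assoc)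
        thus ?thesis unfolding eq using null[of "of_nat i - of_nat j"] False by simp
      qed
    qed
    have "(real n * ?T)\<^sup>2 \<le> m (\<lambda>s. (M (\<lambda>x. c s x * g x))\<^sup>2)"
      unfolding nT by (rule m.mean_square_le[OF bcg])
    also have "\<dots> \<le> m (\<lambda>s. A * M (\<lambda>x. (c s x)\<^sup>2))"
      unfolding A_def using bcg bcc M.mean_cauchy_schwarz[OF bc g]
      by (intro m.mean_mono bfun_intros) (simp_all add: mult.commute)
    also have "\<dots> = A * m (\<lambda>s. M (\<lambda>x. (c s x)\<^sup>2))" by (rule m.mean_scale[OF bcc])
    also have "m (\<lambda>s. M (\<lambda>x. (c s x)\<^sup>2)) = (\<Sum>i<n. \<Sum>j<n. if i = j then B else 0)"
      unfolding cc pair[symmetric]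
      using f by (subst m.mean_sum, intro bfun_intros bfun_corr, assumption+)+ simp
    also have "\<dots> = real n * B" by simp
    finally have "real n * (real n * ?T\<^sup>2) \<le> real n * (A * B)"
      by (simp add: power2_eq_square algebra_simps)
    thus ?thesis using n by simp
  qed
  obtain n :: nat where "A * B < real n * ?T\<^sup>2"
    using nz reals_Archimedean3[of "?T\<^sup>2"] by auto
  moreover have "0 \<le> A * B" using AB by simp
  ultimately show False using bound[of n] by (cases "n = 0") auto
qed

end

section \<open>Polynomial curves and their differences\<close>

definition curve :: "(nat \<Rightarrow> 'k::field ^ 'n) \<Rightarrow> nat \<Rightarrow> 'k \<Rightarrow> 'k ^ 'n" where
  "curve a D s = (\<Sum>k\<le>D. s ^ k *s a k)"

lemma curve_Suc: "curve a (Suc D) s = curve a D s + s ^ Suc D *s a (Suc D)"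
  by (simp add: curve_def)

text \<open>The expansion of \<open>(s + h) ^ k - s ^ k\<close> has no term of degree
  \<open>k\<close>. Exchanging the sums collects the coefficient of \<open>s ^ j\<close> from the
  \<open>a k\<close> with \<open>k > j\<close>.\<close>

lemma curve_diff:
  fixes a :: "nat \<Rightarrow> 'k::field ^ 'n"
  shows "curve a (Suc D) (s + h) - curve a (Suc D) s
    = curve (\<lambda>j. \<Sum>k=Suc j..Suc D. (of_nat (k choose j) * h ^ (k - j)) *s a k) D s"
proof -
  have bin: "(s + h) ^ k - s ^ k = (\<Sum>j<k. of_nat (k choose j) * s ^ j * h ^ (k - j))" for k
    by (simp add: binomial_ring lessThan_Suc_atMost[symmetric])
  have "curve a (Suc D) (s + h) - curve a (Suc D) s = (\<Sum>k\<le>Suc D. ((s + h) ^ k - s ^ k) *s a k)"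
    by (simp only: curve_def sum_subtractf vec.scale_left_diff_distrib)
  also have "\<dots> = (\<Sum>k\<le>Suc D. \<Sum>j<k. (of_nat (k choose j) * s ^ j * h ^ (k - j)) *s a k)"
    by (simp only: bin vec.scale_sum_left)
  also have "\<dots> = (\<Sum>j<Suc D. \<Sum>k=Suc j..Suc D. (of_nat (k choose j) * s ^ j * h ^ (k - j)) *s a k)"
    by (rule sum.nested_swap')
  also have "\<dots> = curve (\<lambda>j. \<Sum>k=Suc j..Suc D. (of_nat (k choose j) * h ^ (k - j)) *s a k) D s"
    unfolding curve_def lessThan_Suc_atMost vec.scale_sum_right
    by (intro sum.cong refl) (simp add: vec.scale_scale mult_ac)
  finally show ?thesis .
qed

lemma eq_zero_if_small:
  fixes x c :: real
  assumes "\<And>\<eta>. \<eta> > 0 \<Longrightarrow> \<bar>x\<bar> \<le> \<eta> * c"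
  shows "x = 0"
proof (rule ccontr)
  assume "x \<noteq> 0"
  hence "0 < \<bar>x\<bar>" by simp
  moreover have "\<bar>x\<bar> \<le> \<bar>x\<bar> / (2 * (\<bar>c\<bar> + 1)) * c"
    using \<open>x \<noteq> 0\<close> by (intro assms) simp
  moreover have "\<bar>x\<bar> / (2 * (\<bar>c\<bar> + 1)) * c \<le> \<bar>x\<bar> / (2 * (\<bar>c\<bar> + 1)) * (\<bar>c\<bar> + 1)"
    by (intro mult_left_mono) simp_all
  moreover have "\<bar>x\<bar> / (2 * (\<bar>c\<bar> + 1)) * (\<bar>c\<bar> + 1) = \<bar>x\<bar> / 2"
    by (simp add: field_simps)
  ultimately show False by linarith
qed

section \<open>Shifts that preserve the correlation along a curve\<close>

locale curve_means = two_means M m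
  for M :: "('k::field_char_0 ^ 'n \<Rightarrow> real) \<Rightarrow> real" and m :: "('k \<Rightarrow> real) \<Rightarrow> real"
begin

lemma corr_diff:
  assumes "bfun f" "bfun f'" "bfun g"
  shows "corr \<phi> (\<lambda>x. f x - f' x) g = corr \<phi> f g - corr \<phi> f' g"
proof -
  have "M (\<lambda>x. (f (x + \<phi> s) - f' (x + \<phi> s)) * g x)
      = M (\<lambda>x. f (x + \<phi> s) * g x) - M (\<lambda>x. f' (x + \<phi> s) * g x)" for s
    using assms by (simp add: left_diff_distrib M.mean_diff bfun_intros)
  thus ?thesis unfolding corr_def using assms by (simp add: m.mean_diff bfun_corr0)
qed

lemma corr_add:
  assumes "bfun f" "bfun f'" "bfun g"
  shows "corr \<phi> (\<lambda>x. f x + f' x) g = corr \<phi> f g + corr \<phi> f' g"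
proof -
  have "M (\<lambda>x. (f (x + \<phi> s) + f' (x + \<phi> s)) * g x)
      = M (\<lambda>x. f (x + \<phi> s) * g x) + M (\<lambda>x. f' (x + \<phi> s) * g x)" for s
    using assms by (simp add: distrib_right M.mean_add bfun_intros)
  thus ?thesis unfolding corr_def using assms by (simp add: m.mean_add bfun_corr0)
qed

lemma corr_scale:
  assumes "bfun f" "bfun g"
  shows "corr \<phi> (\<lambda>x. c * f x) g = c * corr \<phi> f g"
proof -
  have "M (\<lambda>x. c * f (x + \<phi> s) * g x) = c * M (\<lambda>x. f (x + \<phi> s) * g x)" for s
    using assms M.mean_scale[of "\<lambda>x. f (x + \<phi> s) * g x" c] by (simp add: mult.assoc bfun_intros)
  thus ?thesis unfolding corr_def using assms by (simp add: m.mean_scale bfun_corr0)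
qed

text \<open>Quantifying over all \<open>g\<close> matters: differencing produces correlations of
  \<open>f (x + v) - f x\<close> with itself, to which the induction hypothesis must apply.\<close>

definition corr_invariant :: "('k \<Rightarrow> 'k ^ 'n) \<Rightarrow> 'k ^ 'n \<Rightarrow> bool" where
  "corr_invariant \<phi> v \<longleftrightarrow> (\<forall>f g. bfun f \<longrightarrow> bfun g \<longrightarrow> corr \<phi> (\<lambda>x. f (x + v) - f x) g = 0)"

lemma corr_invariantI:
  "(\<And>f g. bfun f \<Longrightarrow> bfun g \<Longrightarrow> corr \<phi> (\<lambda>x. f (x + v) - f x) g = 0) \<Longrightarrow> corr_invariant \<phi> v"
  by (simp add: corr_invariant_def)

lemma corr_invariantD:
  assumes "corr_invariant \<phi> v" "bfun f" "bfun g"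
  shows "corr \<phi> (\<lambda>x. f (x + v)) g = corr \<phi> f g"
  using assms corr_diff[OF bfun_shift[OF assms(2)] assms(2,3), of \<phi> v]
  by (simp add: corr_invariant_def)

lemma corr_invariant_0: "corr_invariant \<phi> 0"
  by (rule corr_invariantI) (simp add: corr_def M.mean_const m.mean_const)

lemma corr_invariant_add:
  assumes "corr_invariant \<phi> v" "corr_invariant \<phi> w"
  shows "corr_invariant \<phi> (v + w)"
proof (rule corr_invariantI)
  fix f g :: "'k ^ 'n \<Rightarrow> real" assume f: "bfun f" and g: "bfun g"
  have "corr \<phi> (\<lambda>x. f (x + (v + w))) g = corr \<phi> f g"
    using corr_invariantD[OF assms(1) bfun_shift[OF f] g, of w] corr_invariantD[OF assms(2) f g]
    by (simp add: add.assoc)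
  thus "corr \<phi> (\<lambda>x. f (x + (v + w)) - f x) g = 0"
    using corr_diff[OF bfun_shift[OF f] f g] by simp
qed

text \<open>Differencing by \<open>h \<noteq> 0\<close> lowers the degree and keeps the direction of the leading coefficient.\<close>

lemma corr_invariant_leading: "corr_invariant (curve a (Suc D)) (y *s a (Suc D))"
proof (induction D arbitrary: a y)
  case 0
  show ?case
  proof (rule corr_invariantI)
    fix f g :: "'k ^ 'n \<Rightarrow> real" assume f: "bfun f" and g: "bfun g"
    let ?\<phi> = "curve a (Suc 0)"
    \<comment> \<open>In degree 1 a shift along the leading coefficient is a translation of the
      parameter, absorbed by the invariance of \<open>m\<close>.\<close>
    have e: "x + ?\<phi> s + y *s a (Suc 0) = x + ?\<phi> (s + y)" for x s
      by (simp add: curve_def vec.scale_left_distrib add_ac)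
    have "corr ?\<phi> (\<lambda>x. f (x + y *s a (Suc 0))) g = corr ?\<phi> f g"
      unfolding corr_def e by (rule m.mean_shift[OF bfun_corr0[OF f g]])
    thus "corr ?\<phi> (\<lambda>x. f (x + y *s a (Suc 0)) - f x) g = 0"
      using corr_diff[OF bfun_shift[OF f] f g] by simp
  qed
next
  case (Suc D)
  show ?case
  proof (rule corr_invariantI)
    fix f g :: "'k ^ 'n \<Rightarrow> real" assume f: "bfun f" and g: "bfun g"
    let ?\<phi> = "curve a (Suc (Suc D))" and ?v = "y *s a (Suc (Suc D))"
    define f' where "f' = (\<lambda>x. f (x + ?v) - f x)"
    have f': "bfun f'" unfolding f'_def by (intro bfun_diff bfun_shift f)
    have "corr ?\<phi> f' g = 0"
    proof (rule van_der_corput[OF f' g])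
      fix h :: 'k assume h: "h \<noteq> 0"
      define b where
        "b j = (\<Sum>k=Suc j..Suc (Suc D). (of_nat (k choose j) * h ^ (k - j)) *s a k)" for j
      \<comment> \<open>The factor is nonzero in characteristic 0, so every multiple of the old
        leading coefficient is a multiple of the new one.\<close>
      have "b (Suc D) = (of_nat (Suc (Suc D)) * h) *s a (Suc (Suc D))"
        by (simp add: b_def)
      hence v: "?v = (y / (of_nat (Suc (Suc D)) * h)) *s b (Suc D)"
        using h by (simp add: vec.scale_scale del: of_nat_Suc)
      have "(\<lambda>s. ?\<phi> (s + h) - ?\<phi> s) = curve b (Suc D)"
        unfolding curve_diff b_def ..
      thus "corr (\<lambda>s. ?\<phi> (s + h) - ?\<phi> s) f' f' = 0"
        using Suc.IH[of b "y / (of_nat (Suc (Suc D)) * h)"] f f' unfolding f'_def v corr_invariant_def by simp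
    qed
    thus "corr ?\<phi> (\<lambda>x. f (x + ?v) - f x) g = 0" by (simp add: f'_def)
  qed
qed

lemma corr_conv_orbit:
  assumes "h \<in> conv_orbit H f" and inv: "\<And>u. u \<in> H \<Longrightarrow> corr_invariant \<phi> u"
    and f: "bfun f" and g: "bfun g"
  shows "corr \<phi> h g = corr \<phi> f g"
  using assms(1)
proof (induction rule: conv_orbit.induct)
  case (shift h u)
  thus ?case using corr_invariantD[OF inv bfun_conv_orbit[OF _ f] g, of u h H] by simp
next
  case (mid h h')
  note b = bfun_conv_orbit[OF mid(1) f] bfun_conv_orbit[OF mid(2) f]
  show ?case
    using mid corr_scale[OF bfun_add[OF b] g, of \<phi> "1/2"] corr_add[OF b g] by simp
qed simp

text \<open>Cauchy-Schwarz bounds the change for each \<open>s\<close>, uniformly in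
  \<open>s\<close>, since shifting by \<open>\<phi> s\<close> preserves the square norm. This allows
  a summand \<open>\<psi>\<close> of the curve to be dropped.\<close>

lemma corr_perturb:
  assumes h: "bfun h" and g: "bfun g" and \<eta>: "0 \<le> \<eta>"
    and inv: "\<And>s. M (\<lambda>x. (h (x + \<psi> s) - h x)\<^sup>2) \<le> \<eta>\<^sup>2"
  shows "\<bar>corr (\<lambda>s. \<phi> s + \<psi> s) h g - corr \<phi> h g\<bar> \<le> \<eta> * sqrt (M (\<lambda>x. (g x)\<^sup>2))"
proof -
  have M0: "0 \<le> M (\<lambda>x. (g x)\<^sup>2)" using g by (intro M.mean_nonneg bfun_intros) simp_all
  have "\<bar>M (\<lambda>x. h (x + (\<phi> s + \<psi> s)) * g x) - M (\<lambda>x. h (x + \<phi> s) * g x)\<bar>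
      \<le> \<eta> * sqrt (M (\<lambda>x. (g x)\<^sup>2))" for s
  proof -
    define d where "d = (\<lambda>x. h (x + \<psi> s) - h x)"
    have d: "bfun d" unfolding d_def by (intro bfun_diff bfun_shift h)
    have "M (\<lambda>x. (d (x + \<phi> s))\<^sup>2) = M (\<lambda>x. (d x)\<^sup>2)"
      by (rule M.mean_shift[OF bfun_power[OF d]])
    hence "\<bar>M (\<lambda>x. d (x + \<phi> s) * g x)\<bar> \<le> \<eta> * sqrt (M (\<lambda>x. (g x)\<^sup>2))"
      using inv[of s] M0 \<eta> by (intro M.mean_cauchy_schwarz_le bfun_shift d g) (simp_all add: d_def)
    moreover have "M (\<lambda>x. d (x + \<phi> s) * g x)
        = M (\<lambda>x. h (x + (\<phi> s + \<psi> s)) * g x) - M (\<lambda>x. h (x + \<phi> s) * g x)"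
      unfolding d_def using M.mean_diff[OF bfun_mult[OF bfun_shift[OF h] g] bfun_mult[OF bfun_shift[OF h] g], of "\<phi> s + \<psi> s" "\<phi> s"]
      by (simp add: left_diff_distrib add.assoc)
    ultimately show ?thesis by simp
  qed
  thus ?thesis
    unfolding corr_def using h g
    by (subst m.mean_diff[symmetric]) (auto intro!: bfun_corr0 m.mean_abs_le)
qed

text \<open>By invariance in the direction of the leading coefficient, \<open>f\<close> can be replaced by a function
  which is almost invariant in that direction; for it the leading term hardly matters.\<close>

lemma corr_invariant_curve:
  assumes "k \<in> {1..D}"
  shows "corr_invariant (curve a D) (y *s a k)"
  using assms
proof (induction D)
  case (Suc D)
  show ?case
  proof (cases "k = Suc D")
    case True
    thus ?thesis using corr_invariant_leading by simp
  next
    case False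
    hence k: "k \<in> {1..D}" using Suc.prems by auto
    show ?thesis
    proof (rule corr_invariantI)
      fix f g :: "'k ^ 'n \<Rightarrow> real" assume f: "bfun f" and g: "bfun g"
      define f' where "f' = (\<lambda>x. f (x + y *s a k) - f x)"
      have f': "bfun f'" unfolding f'_def by (intro bfun_diff bfun_shift f)
      \<comment> \<open>All multiples of the leading coefficient, hence all values of the leading
        term of the curve.\<close>
      define H where "H = range (\<lambda>z. z *s a (Suc D))"
      have H: "corr_invariant (curve a (Suc D)) u" if "u \<in> H" for u
        using that corr_invariant_leading by (auto simp: H_def)
      \<comment> \<open>Shifts and midpoints commute with differencing along
        \<open>y *s a k\<close>, so the almost invariant \<open>h\<close> is again such a difference
        and the induction hypothesis for degree \<open>D\<close> applies to it.\<close>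
      have repr: "\<exists>f1. bfun f1 \<and> h = (\<lambda>x. f1 (x + y *s a k) - f1 x)" if "h \<in> conv_orbit H f'" for h
        using that
      proof (induction rule: conv_orbit.induct)
        case base
        show ?case using f f'_def by blast
      next
        case (shift h u)
        then obtain f1 where "bfun f1" "h = (\<lambda>x. f1 (x + y *s a k) - f1 x)" by blast
        thus ?case by (intro exI[of _ "\<lambda>x. f1 (x + u)"]) (simp add: bfun_shift add_ac)
      next
        case (mid h h')
        then obtain f1 f2 where "bfun f1" "h = (\<lambda>x. f1 (x + y *s a k) - f1 x)"
          "bfun f2" "h' = (\<lambda>x. f2 (x + y *s a k) - f2 x)" by blast
        thus ?case by (intro exI[of _ "\<lambda>x. (f1 x + f2 x) / 2"])
          (simp add: bfun_add bfun_divide add_divide_distrib diff_divide_distrib algebra_simps)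
      qed
      have "\<bar>corr (curve a (Suc D)) f' g\<bar> \<le> \<eta> * sqrt (M (\<lambda>x. (g x)\<^sup>2))" if \<eta>: "\<eta> > 0" for \<eta>
      proof -
        obtain h where h: "h \<in> conv_orbit H f'"
          "\<And>u. u \<in> H \<Longrightarrow> M (\<lambda>x. (h (x + u) - h x)\<^sup>2) \<le> \<eta>\<^sup>2"
          using M.almost_invariant_exists[OF f' \<eta>] by metis
        have "corr (curve a D) h g = 0"
          using repr[OF h(1)] Suc.IH[OF k] g unfolding corr_invariant_def by blast
        moreover have "curve a (Suc D) = (\<lambda>s. curve a D s + s ^ Suc D *s a (Suc D))"
          by (rule ext) (rule curve_Suc)
        moreover have "\<bar>corr (\<lambda>s. curve a D s + s ^ Suc D *s a (Suc D)) h g - corr (curve a D) h g\<bar>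
            \<le> \<eta> * sqrt (M (\<lambda>x. (g x)\<^sup>2))"
          using \<eta> by (intro corr_perturb bfun_conv_orbit[OF h(1) f'] g h(2)) (auto simp: H_def)
        moreover have "corr (curve a (Suc D)) h g = corr (curve a (Suc D)) f' g"
          by (rule corr_conv_orbit[OF h(1) H f' g])
        ultimately show ?thesis by simp
      qed
      hence "corr (curve a (Suc D)) f' g = 0" by (rule eq_zero_if_small)
      thus "corr (curve a (Suc D)) (\<lambda>x. f (x + y *s a k) - f x) g = 0" by (simp add: f'_def)
    qed
  qed
qed simp

text \<open>Replace \<open>f\<close> in the first slot by an almost invariant \<open>h\<close>. The
  correlation is then close to the mean of \<open>h f\<close>, which is close to the mean of the
  square of \<open>h\<close>, and that is at least the square of \<open>M h = M f\<close>.\<close>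

lemma corr_self_ge:
  assumes inv: "\<And>v. corr_invariant \<phi> v" and f: "bfun f"
  shows "(M f)\<^sup>2 \<le> corr \<phi> f f"
proof (rule field_le_epsilon)
  fix e :: real assume e: "e > 0"
  define c where "c = sqrt (M (\<lambda>x. (f x)\<^sup>2))"
  have M0: "0 \<le> M (\<lambda>x. (f x)\<^sup>2)" using f by (intro M.mean_nonneg bfun_intros) simp_all
  hence c: "0 \<le> c" "c\<^sup>2 = M (\<lambda>x. (f x)\<^sup>2)" by (simp_all add: c_def)
  \<comment> \<open>There are two errors of size at most \<open>\<eta> * c\<close>, together at most
    \<open>e\<close>; the \<open>+ 1\<close> covers \<open>c = 0\<close>.\<close>
  define \<eta> where "\<eta> = e / (2 * (c + 1))"
  have \<eta>: "\<eta> > 0" and \<eta>c: "2 * (\<eta> * c) \<le> e"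
    using e c(1) by (simp_all add: \<eta>_def field_simps)
  obtain h where h: "h \<in> conv_orbit UNIV f"
    and hu: "\<And>u. M (\<lambda>x. (h (x + u) - h x)\<^sup>2) \<le> \<eta>\<^sup>2"
    using M.almost_invariant_exists[OF f \<eta>, of UNIV] by auto
  have bh: "bfun h" by (rule bfun_conv_orbit[OF h f])
  have "corr \<phi> f f = corr (\<lambda>s. 0 + \<phi> s) h f"
    using corr_conv_orbit[OF h inv f f] by simp
  moreover have "\<bar>corr (\<lambda>s. 0 + \<phi> s) h f - corr (\<lambda>_. 0) h f\<bar> \<le> \<eta> * c"
    unfolding c_def using \<eta> by (intro corr_perturb bh f hu) simp
  moreover have "corr (\<lambda>_. 0) h f = M (\<lambda>x. h x * f x)" by (simp add: corr_def m.mean_const)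
  \<comment> \<open>Moving a shift from \<open>f\<close> to \<open>h\<close> costs at most
    \<open>\<eta> * c\<close>, and midpoints keep this bound. The free \<open>u\<close> carries the
    induction through shifts; the case used is \<open>h' = h\<close>, \<open>u = 0\<close>.\<close>
  moreover have near: "\<bar>M (\<lambda>x. h x * h' (x + u)) - M (\<lambda>x. h x * f x)\<bar> \<le> \<eta> * c"
    if "h' \<in> conv_orbit UNIV f" for h' u
    using that
  proof (induction arbitrary: u rule: conv_orbit.induct)
    case base
    have "M (\<lambda>x. h x * f (x + u)) = M (\<lambda>x. h (x + - u) * f x)"
      using M.mean_shift[OF bfun_mult[OF bh bfun_shift[OF f]], of "- u" u] by simp
    hence "M (\<lambda>x. h x * f (x + u)) - M (\<lambda>x. h x * f x) = M (\<lambda>x. (h (x + - u) - h x) * f x)"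
      using M.mean_diff[OF bfun_mult[OF bfun_shift[OF bh] f] bfun_mult[OF bh f], of "- u"]
      by (simp add: left_diff_distrib)
    also have "\<bar>\<dots>\<bar> \<le> \<eta> * c"
      using \<eta> c hu[of "- u"] by (intro M.mean_cauchy_schwarz_le bfun_diff bfun_shift bh f) simp_all
    finally show ?case .
  next
    case (shift h' w)
    show ?case using shift.IH[of "u + w"] by (simp add: add_ac)
  next
    case (mid h1 h2)
    note b = bfun_mult[OF bh bfun_shift[OF bfun_conv_orbit[OF mid(1) f]], of u]
      bfun_mult[OF bh bfun_shift[OF bfun_conv_orbit[OF mid(2) f]], of u]
    have "M (\<lambda>x. h x * ((h1 (x + u) + h2 (x + u)) / 2))
        = (M (\<lambda>x. h x * h1 (x + u)) + M (\<lambda>x. h x * h2 (x + u))) / 2"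
      using M.mean_mid[OF b] by (simp add: distrib_left)
    thus ?case using mid.IH[of u] by (simp add: abs_le_iff field_simps)
  qed
  moreover have "(M f)\<^sup>2 \<le> M (\<lambda>x. h x * h x)"
    using M.mean_square_le[OF bh] M.mean_conv_orbit[OF h f] by (simp add: power2_eq_square)
  ultimately show "(M f)\<^sup>2 \<le> corr \<phi> f f + e"
    using near[OF h, of 0] \<eta>c by (simp add: abs_le_iff)
qed

text \<open>The preserving shifts are closed under addition and contain all multiples of the
  \<open>a k\<close> with \<open>1 \<le> k \<le> D\<close>, hence their whole span.\<close>

lemma corr_curve_self_ge:
  assumes span: "vec.span (a ` {1..D}) = UNIV" and f: "bfun f"
  shows "(M f)\<^sup>2 \<le> corr (curve a D) f f"
proof (rule corr_self_ge[OF _ f])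
  fix v
  have "v \<in> vec.span (a ` {1..D})" using span by simp
  thus "corr_invariant (curve a D) v"
    by (induction rule: vec.span_induct_alt)
      (auto intro!: corr_invariant_0 corr_invariant_add corr_invariant_curve)
qed

end

subsection \<open>Absolute values\<close>

text \<open>A common interface to the real and the p-adic absolute value. The last axiom excludes
  the trivial absolute value, for which the whole field is bounded.\<close>

locale abs_value =
  fixes nrm :: "'k::field \<Rightarrow> real"
  assumes nrm_nonneg: "0 \<le> nrm x"
    and nrm_eq_0: "nrm x = 0 \<longleftrightarrow> x = 0"
    and nrm_mult: "nrm (x * y) = nrm x * nrm y"
    and nrm_triangle: "nrm (x + y) \<le> nrm x + nrm y"
    and nrm_unbounded: "\<exists>x. nrm x > 1"
begin

lemma nrm_1: "nrm 1 = 1"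
  using nrm_mult[of 1 1] nrm_eq_0[of 1] by simp

lemma nrm_minus: "nrm (- x) = nrm x"
proof -
  have "(nrm (- x))\<^sup>2 = (nrm x)\<^sup>2"
    using nrm_mult[of "- x" "- x"] nrm_mult[of x x] by (simp add: power2_eq_square)
  thus ?thesis using nrm_nonneg by (simp add: power2_eq_iff_nonneg)
qed

lemma nrm_diff_ge: "nrm x - nrm y \<le> nrm (x + y)"
  using nrm_triangle[of "x + y" "- y"] by (simp add: nrm_minus)

lemma nrm_power: "nrm (x ^ n) = nrm x ^ n"
  by (induction n) (simp_all add: nrm_1 nrm_mult)

text \<open>Induction along Horner's scheme: if \<open>q\<close> is nonconstant, its value at large
  \<open>s\<close> exceeds 1, so \<open>a + s q(s)\<close> has absolute value at least that of
  \<open>s\<close> minus that of \<open>a\<close>.\<close>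

lemma poly_unbounded:
  assumes "Polynomial.degree p > 0"
  shows "\<exists>R. \<forall>s. nrm s > R \<longrightarrow> nrm (poly p s) > C"
  using assms
proof (induction p arbitrary: C)
  case (pCons a q)
  show ?case
  proof (cases "Polynomial.degree q = 0")
    case True
    then obtain c where q: "q = [:c:]" by (metis degree_eq_zeroE)
    have "q \<noteq> 0" using pCons.prems by auto
    hence "nrm c \<noteq> 0" by (simp add: q nrm_eq_0)
    hence c: "nrm c > 0" using nrm_nonneg[of c] by linarith
    have "nrm (poly (pCons a q) s) > C" if "nrm s > (C + nrm a) / nrm c" for s
    proof -
      have "C < nrm (s * c) - nrm a" using that c by (simp add: field_simps nrm_mult)
      thus ?thesis using nrm_diff_ge[of "s * c" a] by (simp add: q add.commute)
    qed
    thus ?thesis by blast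
  next
    case False
    then obtain R where R: "\<And>s. nrm s > R \<Longrightarrow> nrm (poly q s) > 1"
      using pCons.IH[of 1] by auto
    have "nrm (poly (pCons a q) s) > C" if "nrm s > max R (C + nrm a)" for s
    proof -
      have "nrm s * 1 \<le> nrm s * nrm (poly q s)"
        using R[of s] that nrm_nonneg[of s] by (intro mult_left_mono) auto
      hence "C < nrm (s * poly q s) - nrm a" using that by (simp add: nrm_mult)
      thus ?thesis using nrm_diff_ge[of "s * poly q s" a] by (simp add: add.commute)
    qed
    thus ?thesis by blast
  qed
qed simp

end

text \<open>The translates of \<open>A\<close> by the \<open>- t i\<close> are pairwise disjoint and
  of equal mean, so \<open>n\<close> times this mean is at most 1 for every
  \<open>n\<close>.\<close>

lemma (in invariant_mean) mean_indicator_null: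
  fixes t :: "nat \<Rightarrow> 'a"
  assumes "\<And>i j x. i < j \<Longrightarrow> x + t i \<in> A \<Longrightarrow> x + t j \<notin> A"
  shows "M (indicator A) = 0"
proof (rule ccontr)
  assume nz: "M (indicator A) \<noteq> 0"
  have "0 \<le> M (indicator A)" by (intro mean_nonneg bfun_intros) simp
  hence pos: "0 < M (indicator A)" using nz by simp
  have "real n * M (indicator A) \<le> 1" for n :: nat
  proof -
    have inj: "i = j" if "x + t i \<in> A" "x + t j \<in> A" for x i j
      using assms[of i j x] assms[of j i x] that by (cases i j rule: linorder_cases) auto
    have "(\<Sum>i<n. indicat_real A (x + t i)) \<le> 1" for x
    proof -
      have "(\<Sum>i<n. indicat_real A (x + t i)) = card {i \<in> {..<n}. x + t i \<in> A}"
        by (simp add: indicator_def sum.If_cases Int_def)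
      also have "card {i \<in> {..<n}. x + t i \<in> A} \<le> 1"
        unfolding One_nat_def by (subst card_le_Suc0_iff_eq) (simp, blast intro: inj)
      finally show ?thesis by simp
    qed
    hence "M (\<lambda>x. \<Sum>i<n. indicat_real A (x + t i)) \<le> M (\<lambda>_. 1)"
      by (rule mean_mono[OF bfun_sum[OF bfun_shift[OF bfun_indicat]] bfun_const])
    also have "M (\<lambda>x. \<Sum>i<n. indicat_real A (x + t i)) = (\<Sum>i<n. M (\<lambda>x. indicat_real A (x + t i)))"
      by (rule mean_sum[OF bfun_shift[OF bfun_indicat]])
    also have "\<dots> = real n * M (indicator A)"
      by (simp add: mean_shift[OF bfun_indicat])
    finally show ?thesis by (simp add: mean_one)
  qed
  moreover obtain n :: nat where "1 < real n * M (indicator A)"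
    using reals_Archimedean3[OF pos] by blast
  ultimately show False by (metis linorder_not_less)
qed

text \<open>Distinct powers of an element of absolute value above
  \<open>2 * \<bar>R\<bar> + 1\<close> are more than \<open>2 * \<bar>R\<bar>\<close> apart, so they
  separate the translates of \<open>A\<close>.\<close>

lemma (in abs_value) mean_bounded_null:
  assumes "invariant_mean m" and A: "\<And>x. x \<in> A \<Longrightarrow> nrm x \<le> R"
  shows "m (indicator A) = 0"
proof -
  interpret invariant_mean m by fact
  obtain x0 where "nrm x0 > 1" using nrm_unbounded by blast
  then obtain n where n: "2 * \<bar>R\<bar> + 1 < nrm x0 ^ n" using real_arch_pow by blast
  define x where "x = x0 ^ n"
  have x: "nrm x > 2 * \<bar>R\<bar> + 1" using n by (simp add: x_def nrm_power)
  show ?thesis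
  proof (rule mean_indicator_null[where t = "\<lambda>i. x ^ i"])
    fix i j u assume ij: "(i::nat) < j" and u: "u + x ^ i \<in> A"
    show "u + x ^ j \<notin> A"
    proof
      assume "u + x ^ j \<in> A"
      hence "nrm (x ^ j + - (x ^ i)) \<le> 2 * \<bar>R\<bar>"
        using u A[of "u + x ^ i"] A[of "u + x ^ j"] nrm_triangle[of "u + x ^ j" "- (u + x ^ i)"]
        unfolding nrm_minus by simp
      hence le: "nrm x ^ j - nrm x ^ i \<le> 2 * \<bar>R\<bar>"
        using nrm_diff_ge[of "x ^ j" "- (x ^ i)"] by (simp add: nrm_minus nrm_power)
      have "nrm x ^ Suc i \<le> nrm x ^ j" using ij x by (intro power_increasing) auto
      moreover have "1 \<le> nrm x ^ i" using x by (intro one_le_power) simp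
      hence "1 * (nrm x - 1) \<le> nrm x ^ i * (nrm x - 1)" using x by (intro mult_right_mono) auto
      ultimately show False using le x by (simp add: algebra_simps)
    qed
  qed
qed

subsection \<open>From several variables to a curve\<close>

text \<open>A linear map that kills a basis of the span and fixes some \<open>v\<close> outside it;
  its row at a nonzero coordinate \<open>j\<close> of \<open>v\<close> is the vector
  \<open>c\<close>.\<close>

lemma orthogonal_to_span:
  fixes S :: "('k::field ^ 'n) set"
  assumes "vec.span S \<noteq> UNIV"
  obtains c where "c \<noteq> 0" "\<And>x. x \<in> S \<Longrightarrow> (\<Sum>i\<in>UNIV. c $ i * x $ i) = 0"
proof -
  obtain v where v: "v \<notin> vec.span S" using assms by blast
  obtain B where B: "B \<subseteq> S" "vec.independent B" "S \<subseteq> vec.span B"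
    using vec.maximal_independent_subset[of S] by blast
  have vB: "v \<notin> vec.span B" using v B(1) vec.span_mono by blast
  obtain f where f: "Vector_Spaces.linear (*s) (*s) f"
    "\<forall>x\<in>insert v B. f x = (if x = v then v else 0)"
    using vec.linear_independent_extend[OF vec.independent_insertI[OF vB B(2)], of "\<lambda>x. if x = v then v else 0"] by blast
  have "v \<notin> B" using vB vec.span_base[of v B] by blast
  hence fB: "f b = 0" if "b \<in> B" for b using f(2) that by auto
  have f0: "f x = 0" if "x \<in> S" for x
    by (rule vec.linear_eq_0_on_span[OF f(1) fB]) (use B(3) that in auto)
  have "v \<noteq> 0" using v vec.span_zero[of S] by blast
  then obtain j where j: "v $ j \<noteq> 0" by (metis vec_eq_iff zero_index)
  define c where "c = (\<chi> i. f (axis i 1) $ j)"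
  have fx: "f x $ j = (\<Sum>i\<in>UNIV. c $ i * x $ i)" for x
  proof -
    have "f x = f (\<Sum>i\<in>UNIV. x $ i *s axis i 1)" by (simp add: basis_expansion)
    also have "\<dots> = (\<Sum>i\<in>UNIV. x $ i *s f (axis i 1))"
      by (simp add: vec.linear_sum[OF f(1)] vec.linear_scale[OF f(1)])
    finally show ?thesis by (simp add: c_def mult.commute)
  qed
  show ?thesis
  proof (rule that)
    show "c \<noteq> 0" using fx[of v] f(2) j by auto
    show "(\<Sum>i\<in>UNIV. c $ i * x $ i) = 0" if "x \<in> S" for x
      using fx[of x] f0[OF that] by simp
  qed
qed

text \<open>Kronecker substitution: \<open>s\<^sub>j = x ^ n\<^sub>j\<close> maps the monomials with exponents in \<open>E\<close> to distinct powers of \<open>x\<close>.\<close>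

lemma kronecker_weights:
  fixes E :: "('d::finite \<Rightarrow>\<^sub>0 nat) set"
  assumes "finite E"
  obtains n :: "'d \<Rightarrow> nat" where "inj_on (\<lambda>e. \<Sum>j\<in>UNIV. n j * Poly_Mapping.lookup e j) E"
proof -
  obtain idx :: "'d \<Rightarrow> nat" where idx: "inj idx"
    using finite_imp_inj_to_nat_seg[of "UNIV :: 'd set"] by auto
  \<comment> \<open>Encoding exponent vectors as integer polynomials turns the weighted degree with
    weights \<open>t ^ idx j\<close> into the value at \<open>t\<close>. Distinct polynomials agree
    at finitely many points, so some \<open>t\<close> separates all of \<open>E\<close>.\<close>
  define p where "p e = (\<Sum>j\<in>UNIV. Polynomial.monom (int (Poly_Mapping.lookup e j)) (idx j))"
    for e :: "'d \<Rightarrow>\<^sub>0 nat"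
  have coeff: "Polynomial.coeff (p e) (idx j) = int (Poly_Mapping.lookup e j)" for e j
    unfolding p_def coeff_sum coeff_monom using idx
    by (simp add: inj_eq)
  have inj: "e = e'" if "p e = p e'" for e e'
    using coeff[of e] coeff[of e'] that by (intro poly_mapping_eqI) (metis of_nat_eq_iff)
  define X where "X = (\<Union>(e, e')\<in>{(e, e') \<in> E \<times> E. e \<noteq> e'}. {x. poly (p e - p e') x = 0})"
  have "finite {x. poly (p e - p e') x = 0}" if "e \<noteq> e'" for e e'
    using inj that by (intro poly_roots_finite) auto
  hence "finite X"
    unfolding X_def using assms
    by (intro finite_UN_I) (auto simp del: poly_diff intro: finite_subset[of _ "E \<times> E"])
  moreover have "infinite (range int)" by (simp add: range_inj_infinite)
  ultimately obtain t where t: "int t \<notin> X" by (metis finite_subset image_subsetI)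
  have eval: "poly (p e) (int t) = int (\<Sum>j\<in>UNIV. t ^ idx j * Poly_Mapping.lookup e j)" for e
    by (simp add: p_def poly_sum poly_monom mult.commute)
  show ?thesis
  proof (rule that[of "\<lambda>j. t ^ idx j"], rule inj_onI, rule ccontr)
    fix e e' assume e: "e \<in> E" "e' \<in> E" "e \<noteq> e'"
      and eq: "(\<Sum>j\<in>UNIV. t ^ idx j * Poly_Mapping.lookup e j)
        = (\<Sum>j\<in>UNIV. t ^ idx j * Poly_Mapping.lookup e' j)"
    have "poly (p e - p e') (int t) = 0" using eq eval[of e] eval[of e'] by simp
    thus False using t e by (auto simp: X_def)
  qed
qed

lemma lookup_single_0_times:
  "Poly_Mapping.lookup (Poly_Mapping.single 0 c * P) e = c * Poly_Mapping.lookup P e"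
  for P :: "('d, 'k::field) mpolynomial"
  unfolding mult_map_scale_conv_mult[symmetric] by (simp add: Poly_Mapping.map.rep_eq when_def)

text \<open>Since the weights separate monomials, the nonzero coefficients of the curve are the
  coefficient vectors of \<open>F\<close>. If those of positive weight did not span, an orthogonal
  \<open>c\<close> would make a nontrivial combination of the \<open>F i\<close> constant.\<close>

lemma lin_indep_imp_spanning_curve:
  fixes F :: "'m::finite \<Rightarrow> ('d::finite, 'k::field) mpolynomial"
  assumes "lin_indep_family (with_one F)"
  obtains a D where "vec.span (a ` {1..D}) = UNIV" "range (curve a D) \<subseteq> pm_values F"
proof -
  \<comment> \<open>Including 0 reserves weight 0 for the constant monomial, so all others in
    \<open>E\<close> have weight at least 1.\<close>
  define E where "E = insert 0 (\<Union>i. Poly_Mapping.keys (F i))"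
  have E: "finite E" by (simp add: E_def)
  have keys: "e \<in> E" if "e \<in> Poly_Mapping.keys (F i)" for e i
    using that by (auto simp: E_def)
  obtain n where inj: "inj_on (\<lambda>e. \<Sum>j\<in>UNIV. n j * Poly_Mapping.lookup e j) E"
    using kronecker_weights[OF E] by blast
  define w where "w = (\<lambda>e :: 'd \<Rightarrow>\<^sub>0 nat. \<Sum>j\<in>UNIV. n j * Poly_Mapping.lookup e j)"
  have inj: "inj_on w E" using inj by (simp add: w_def)
  have w0: "w 0 = 0" by (simp add: w_def)
  define a :: "nat \<Rightarrow> 'k ^ 'm" where
    "a k = (\<chi> i. \<Sum>e\<in>{e \<in> Poly_Mapping.keys (F i). w e = k}. Poly_Mapping.lookup (F i) e)" for k
  define D where "D = Max (w ` E)"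
  have D: "w e \<le> D" if "e \<in> E" for e unfolding D_def using that E by (intro Max_ge) auto
  have a: "a (w e) $ i = Poly_Mapping.lookup (F i) e" if "e \<in> E" for e i
  proof -
    have "{e' \<in> Poly_Mapping.keys (F i). w e' = w e} = (if e \<in> Poly_Mapping.keys (F i) then {e} else {})"
      using inj that keys by (auto dest: inj_onD)
    thus ?thesis by (auto simp: a_def in_keys_iff)
  qed
  have "curve a D x $ i = mpoly_eval (F i) (\<chi> j. x ^ n j)" for x i
  proof -
    have "curve a D x $ i
        = (\<Sum>k\<in>{..D}. \<Sum>e\<in>{e \<in> Poly_Mapping.keys (F i). w e = k}. x ^ w e * Poly_Mapping.lookup (F i) e)"
      by (simp add: curve_def a_def sum_distrib_left)
    also have "\<dots> = (\<Sum>e\<in>Poly_Mapping.keys (F i). x ^ w e * Poly_Mapping.lookup (F i) e)"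
      by (rule sum.group) (use D keys in auto)
    also have "\<dots> = mpoly_eval (F i) (\<chi> j. x ^ n j)"
      by (simp add: mpoly_eval_def w_def power_sum power_mult mult.commute)
    finally show ?thesis .
  qed
  hence "curve a D x = (\<chi> i. mpoly_eval (F i) (\<chi> j. x ^ n j))" for x by (simp add: vec_eq_iff)
  hence "range (curve a D) \<subseteq> pm_values F" by (auto simp: pm_values_def)
  moreover have "vec.span (a ` {1..D}) = UNIV"
  proof (rule ccontr)
    assume "vec.span (a ` {1..D}) \<noteq> UNIV"
    then obtain c where c: "c \<noteq> 0" "\<And>x. x \<in> a ` {1..D} \<Longrightarrow> (\<Sum>i\<in>UNIV. c $ i * x $ i) = 0"
      using orthogonal_to_span by blast
    \<comment> \<open>The coefficient at \<open>None\<close>, that of the polynomial 1, cancels the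
      constant term of the combination.\<close>
    define c' where "c' = case_option (- (\<Sum>i\<in>UNIV. c $ i * Poly_Mapping.lookup (F i) 0)) (\<lambda>i. c $ i)"
    have "(\<Sum>i\<in>UNIV. Poly_Mapping.single 0 (c' i) * with_one F i) = 0"
    proof (rule poly_mapping_eqI)
      fix e
      have "Poly_Mapping.lookup (\<Sum>i\<in>UNIV. Poly_Mapping.single 0 (c' i) * with_one F i) e
          = (\<Sum>i\<in>UNIV. c' i * Poly_Mapping.lookup (with_one F i) e)"
        by (simp add: lookup_sum lookup_single_0_times)
      also have "\<dots> = c' None * Poly_Mapping.lookup 1 e + (\<Sum>i\<in>UNIV. c $ i * Poly_Mapping.lookup (F i) e)"
        by (simp add: UNIV_option_conv sum.reindex with_one_def c'_def)
      also have "\<dots> = 0"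
      proof (cases "e = 0")
        case True
        thus ?thesis by (simp add: c'_def lookup_one)
      next
        case False
        have "(\<Sum>i\<in>UNIV. c $ i * Poly_Mapping.lookup (F i) e) = 0"
        proof (cases "e \<in> E")
          case True
          have "0 \<in> E" by (simp add: E_def)
          hence "w e \<noteq> w 0" using inj_onD[OF inj, of e 0] True False by blast
          hence "w e \<in> {1..D}" using D[OF True] by (simp add: w0)
          thus ?thesis using c(2)[of "a (w e)"] a[OF True] by simp
        next
          case False
          hence "Poly_Mapping.lookup (F i) e = 0" for i using keys by (auto simp: in_keys_iff)
          thus ?thesis by simp
        qed
        thus ?thesis using False by (simp add: lookup_one)
      qed
      finally show "Poly_Mapping.lookup (\<Sum>i\<in>UNIV. Poly_Mapping.single 0 (c' i) * with_one F i) e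
          = Poly_Mapping.lookup 0 e" by simp
    qed
    hence "c' (Some i) = 0" for i using assms unfolding lin_indep_family_def by blast
    thus False using c(1) by (simp add: c'_def vec_eq_iff)
  qed
  ultimately show ?thesis using that by blast
qed

subsection \<open>Colourings\<close>

lemma sum_indicator_partition:
  assumes "partition_on UNIV P" "finite P"
  shows "(\<Sum>A\<in>P. indicat_real A x) = 1"
proof -
  have "x \<in> \<Union> P" using assms(1) by (simp add: partition_on_def)
  then obtain A where A: "A \<in> P" "x \<in> A" by blast
  have "indicat_real A' x = (if A' = A then 1 else 0)" if "A' \<in> P" for A'
    using that A partition_onD2[OF assms(1)] by (auto simp: disjoint_def indicator_def)
  hence "(\<Sum>A'\<in>P. indicat_real A' x) = (\<Sum>A'\<in>P. if A' = A then 1 else 0)" by (rule sum.cong[OF refl])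
  thus ?thesis using A assms by simp
qed

lemma curve_component: "curve a D s $ i = poly (\<Sum>k\<le>D. Polynomial.monom (a k $ i) k) s"
  by (simp add: curve_def poly_sum poly_monom mult.commute)

text \<open>Boundedness of \<open>B\<close> is stated by coordinates, which fits Euclidean and
  supremum-norm balls alike.\<close>

lemma no_finite_coloring:
  fixes F :: "'m::finite \<Rightarrow> ('d::finite, 'k::field_char_0) mpolynomial"
  assumes "abs_value nrm" and F: "lin_indep_family (with_one F)"
    and B: "\<And>v i. v \<in> B \<Longrightarrow> nrm (v $ i) \<le> C"
    and P: "partition_on UNIV P" "finite P"
    and indep: "\<And>A x y. A \<in> P \<Longrightarrow> x \<in> A \<Longrightarrow> y \<in> A \<Longrightarrow> (x, y) \<notin> Cay (pm_values F - B)"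
  shows False
proof -
  interpret abs_value nrm by fact
  obtain M :: "('k ^ 'm \<Rightarrow> real) \<Rightarrow> real" where "invariant_mean M"
    using invariant_mean_exists by blast
  moreover obtain m :: "('k \<Rightarrow> real) \<Rightarrow> real" where m: "invariant_mean m"
    using invariant_mean_exists by blast
  ultimately interpret curve_means M m by (simp add: curve_means_def two_means_def)
  obtain a :: "nat \<Rightarrow> 'k ^ 'm" and D
    where span: "vec.span (a ` {1..D}) = UNIV" and range: "range (curve a D) \<subseteq> pm_values F"
    using lin_indep_imp_spanning_curve[OF F] by blast
  have "(\<Sum>A\<in>P. M (indicator A)) = M (\<lambda>x. \<Sum>A\<in>P. indicat_real A x)"
    by (rule M.mean_sum[symmetric]) (rule bfun_indicat)
  also have "\<dots> = 1" by (simp add: sum_indicator_partition[OF P] M.mean_one)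
  finally obtain A where A: "A \<in> P" "M (indicator A) \<noteq> 0"
    by (metis sum.neutral zero_neq_one)
  let ?f = "indicat_real A"
  define bad where "bad = {s. curve a D s \<in> B}"
  \<comment> \<open>For \<open>s\<close> outside \<open>bad\<close> the vector
    \<open>curve a D s\<close> joins \<open>x\<close> to \<open>x + curve a D s\<close>, so these
    are never both in \<open>A\<close>.\<close>
  have bound: "\<bar>M (\<lambda>x. ?f (x + curve a D s) * ?f x)\<bar> \<le> indicator bad s" for s
  proof (cases "s \<in> bad")
    case True
    thus ?thesis by (intro M.mean_abs_le) (auto simp: indicator_def)
  next
    case False
    have "?f (x + curve a D s) * ?f x = 0" for x
    proof (rule ccontr)
      assume "?f (x + curve a D s) * ?f x \<noteq> 0"
      hence "x + curve a D s \<in> A" "x \<in> A" by (auto simp: indicator_def split: if_splits)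
      hence "(x + curve a D s, x) \<notin> Cay (pm_values F - B)" using indep A(1) by blast
      thus False using False range by (auto simp: Cay_def bad_def)
    qed
    hence "M (\<lambda>x. ?f (x + curve a D s) * ?f x) = 0" by (simp only: M.mean_const)
    thus ?thesis by simp
  qed
  \<comment> \<open>The space is nonzero, as \<open>axis undefined 1\<close> shows, so some
    nonconstant coefficient is nonzero. Its coordinate \<open>i\<close> is a nonconstant polynomial
    in \<open>s\<close>, which makes \<open>bad\<close> bounded.\<close>
  have "\<exists>k\<in>{1..D}. \<exists>i. a k $ i \<noteq> 0"
  proof (rule ccontr)
    assume "\<not> ?thesis"
    hence "a ` {1..D} \<subseteq> {0}" by (auto simp: vec_eq_iff)
    hence "vec.span (a ` {1..D}) \<subseteq> {0}"
      by (rule vec.span_minimal[OF _ vec.subspace_single_0])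
    hence "(axis undefined 1 :: 'k ^ 'm) = 0" unfolding span by blast
    thus False by (simp add: axis_eq_0_iff)
  qed
  then obtain k i where k: "k \<in> {1..D}" "a k $ i \<noteq> 0" by blast
  define p where "p = (\<Sum>k\<le>D. Polynomial.monom (a k $ i) k)"
  have "Polynomial.coeff p k \<noteq> 0" using k by (simp add: p_def coeff_sum)
  hence "k \<le> Polynomial.degree p" by (rule le_degree)
  hence "Polynomial.degree p > 0" using k by simp
  then obtain R where R: "\<And>s. nrm s > R \<Longrightarrow> nrm (poly p s) > C"
    using poly_unbounded by blast
  have "nrm s \<le> R" if "s \<in> bad" for s
  proof (rule ccontr)
    assume "\<not> nrm s \<le> R"
    hence "nrm (curve a D s $ i) > C" using R by (simp add: curve_component p_def)
    thus False using B[of "curve a D s" i] that by (simp add: bad_def)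
  qed
  hence null: "m (indicator bad) = 0" by (rule mean_bounded_null[OF m])
  have "(M ?f)\<^sup>2 \<le> corr (curve a D) ?f ?f"
    by (rule corr_curve_self_ge[OF span bfun_indicat])
  also have "\<dots> \<le> m (indicator bad)"
    unfolding corr_def using bound
    by (intro m.mean_mono bfun_corr0 bfun_indicat) (auto simp: abs_le_iff)
  finally show False using A(2) null by simp
qed

section \<open>Countable Borel colourings and the exact cardinal\<close>

lemma countable_borel_coloring:
  fixes E :: "'a::metric_space rel" and D :: "'a set"
  assumes D: "countable D" "\<And>x. \<exists>d\<in>D. dist d x < r / 2"
    and E: "\<And>x y. (x, y) \<in> E \<Longrightarrow> r \<le> dist x y"
  shows "\<exists>P. borel_coloring E P \<and> countable P"
proof -
  define B where "B n = ball (from_nat_into D n) (r / 2)" for n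
  \<comment> \<open>Removing earlier balls makes the colours disjoint and keeps them Borel; empty
    pieces go because a partition has none.\<close>
  define P where "P = range (disjointed B) - {{}}"
  have "x \<in> (\<Union>n. B n)" for x
  proof -
    obtain d where d: "d \<in> D" "dist d x < r / 2" using D(2) by blast
    obtain n where "from_nat_into D n = d" using from_nat_into_surj[OF D(1) d(1)] by blast
    thus ?thesis using d(2) by (auto simp: B_def)
  qed
  hence "(\<Union>n. disjointed B n) = UNIV" by (auto simp: UN_disjointed_eq)
  hence "\<Union> P = UNIV" unfolding P_def by blast
  moreover have "disjoint P"
  proof (rule disjointI)
    fix X Y assume "X \<in> P" "Y \<in> P" "X \<noteq> Y"
    then obtain i j where "X = disjointed B i" "Y = disjointed B j" "i \<noteq> j"
      by (auto simp: P_def)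
    thus "X \<inter> Y = {}"
      using disjoint_family_onD[OF disjoint_family_disjointed[of B]] by simp
  qed
  ultimately have "partition_on UNIV P" by (auto simp: partition_on_def P_def)
  moreover have "P \<subseteq> sets borel"
    unfolding P_def B_def by (auto simp: disjointed_def)
  moreover have "(x, y) \<notin> E" if A: "A \<in> P" "x \<in> A" "y \<in> A" for A x y
  proof
    assume "(x, y) \<in> E"
    hence le: "r \<le> dist x y" by (rule E)
    obtain n where "A \<subseteq> B n" using A(1) disjointed_subset[of B] by (auto simp: P_def)
    hence "dist (from_nat_into D n) x < r / 2" "dist (from_nat_into D n) y < r / 2"
      using A by (auto simp: B_def)
    thus False using le dist_triangle2[of x y "from_nat_into D n"] by (simp add: dist_commute)
  qed
  ultimately show ?thesis
    by (intro exI[of _ P]) (auto simp: borel_coloring_def P_def)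
qed

lemma borel_chromatic_number_eq_natLeq:
  assumes P0: "borel_coloring E P0" "countable P0"
    and inf: "\<And>P. borel_coloring E P \<Longrightarrow> infinite P"
  shows "(borel_chromatic_number E, natLeq) \<in> ordIso"
proof -
  obtain P where P: "borel_coloring E P" "borel_chromatic_number E = |P|" "|P| \<le>o |P0|"
    using borel_chromatic_number_attained[OF P0(1)] P0(1) by blast
  have "|P0| \<le>o |UNIV :: nat set|"
    using P0(2) unfolding countable_def by (metis card_of_ordLeqI UNIV_I)
  hence "|P| \<le>o natLeq"
    using P(3) card_of_nat ordLeq_transitive ordLeq_ordIso_trans by blast
  moreover have "natLeq \<le>o |P|"
    using inf[OF P(1)] infinite_iff_natLeq_ordLeq by blast
  ultimately show ?thesis unfolding P(2) by (simp add: ordIso_iff_ordLeq)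
qed

text \<open>\<open>nrm\<close> serves the lower bound and \<open>dist\<close> the upper one; the two
  are related only through \<open>B\<close>.\<close>

lemma borel_chromatic_number_Cay:
  fixes F :: "'m::finite \<Rightarrow> ('d::finite, 'k::{field_char_0, metric_space}) mpolynomial" and D :: "('k ^ 'm) set"
  assumes "abs_value nrm" "lin_indep_family (with_one F)"
    and "\<And>v i. v \<in> B \<Longrightarrow> nrm (v $ i) \<le> C"
    and "\<And>x y. x - y \<notin> B \<Longrightarrow> r \<le> dist x y"
    and "countable D" "\<And>x. \<exists>d\<in>D. dist d x < r / 2"
  shows "(borel_chromatic_number (Cay (pm_values F - B)), natLeq) \<in> ordIso"
proof -
  have "\<exists>P. borel_coloring (Cay (pm_values F - B)) P \<and> countable P"
    using assms(4) by (intro countable_borel_coloring[OF assms(5,6)]) (auto simp: Cay_def)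
  moreover have "infinite P" if "borel_coloring (Cay (pm_values F - B)) P" for P
    using that no_finite_coloring[OF assms(1-3), of B P] unfolding borel_coloring_def by blast
  ultimately show ?thesis using borel_chromatic_number_eq_natLeq by blast
qed

section \<open>The real and the p-adic case\<close>

lemma abs_value_real: "abs_value (abs :: real \<Rightarrow> real)"
  by unfold_locales (auto simp: abs_mult intro: exI[of _ 2])

lemma abs_value_padic: "abs_value (padic_norm :: 'p::prime_card padic \<Rightarrow> real)"
proof
  fix x y :: "'p padic"
  show "padic_norm (x + y) \<le> padic_norm x + padic_norm y"
    using padic_norm_ultrametric[of x y] padic_norm_nonneg[of x] padic_norm_nonneg[of y] by linarith
  have p: "prime CARD('p)" by (rule prime_card)
  have p1: "1 < CARD('p)" by (rule prime_gt_1_nat[OF p])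
  \<comment> \<open>\<open>1/p\<close> has absolute value \<open>p\<close>, which witnesses
    unboundedness.\<close>
  have "rat_padic_abs CARD('p) (of_int 1 / of_int (int CARD('p))) = real CARD('p)"
    using rat_padic_abs_quotient[OF p, of 1 "int CARD('p)"] p1 by (simp add: multiplicity_self)
  hence "padic_norm (of_rat (of_int 1 / of_int (int CARD('p))) :: 'p padic) > 1"
    unfolding padic_norm_of_rat using p1 by simp
  thus "\<exists>x :: 'p padic. padic_norm x > 1" by blast
qed (rule padic_norm_nonneg padic_norm_eq_0 padic_norm_mult)+

lift_definition padic_of_rat :: "rat \<Rightarrow> 'p::prime_card padic" is "\<lambda>q _. q"
  by (simp add: padic_rel_def prime_card)

text \<open>A late term of a Cauchy sequence representing \<open>x\<close> is close to all later
  terms, hence to \<open>x\<close>. Half of \<open>e\<close> is used since limits only preserve weak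
  inequalities.\<close>

lemma padic_of_rat_dense:
  assumes "e > 0"
  shows "\<exists>q. dist (padic_of_rat q) (x :: 'p::prime_card padic) < e"
  unfolding dist_padic_def minus_padic_def
proof (transfer fixing: e)
  fix X assume "padic_rel CARD('p) X X"
  hence X: "padic_Cauchy CARD('p) X" by (simp add: padic_rel_def)
  obtain K where K: "\<And>m n. m \<ge> K \<Longrightarrow> n \<ge> K \<Longrightarrow> rat_padic_abs CARD('p) (X m - X n) < e / 2"
    using padic_CauchyE[OF X] assms by (metis half_gt_zero)
  have "padic_Cauchy CARD('p) (\<lambda>n. X K + - X n)"
    by (intro padic_Cauchy_add padic_Cauchy_minus padic_Cauchy_const prime_card X)
  from padic_abs_lim[OF this]
  have "lim (\<lambda>n. rat_padic_abs CARD('p) (X K + - X n)) \<le> e / 2"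
    by (rule LIMSEQ_le_const2) (use K[of K] in \<open>auto intro!: exI[of _ K] less_imp_le\<close>)
  thus "\<exists>q. lim (\<lambda>n. rat_padic_abs CARD('p) (q + - X n)) < e"
    using assms by (intro exI[of _ "X K"]) simp
qed

text \<open>\<open>dist\<close> on vectors is at most the sum of the coordinate distances, so each
  coordinate is granted \<open>e / CARD('m)\<close>.\<close>

lemma padic_vec_dense:
  assumes "e > 0"
  shows "\<exists>d\<in>range (\<lambda>q. \<chi> i. padic_of_rat (q i)). dist d (x :: 'p::prime_card padic ^ 'm::finite) < e"
proof -
  have "\<exists>q. dist (padic_of_rat q) (x $ i) < e / CARD('m)" for i
    using assms by (intro padic_of_rat_dense) simp
  then obtain q where q: "\<And>i. dist (padic_of_rat (q i)) (x $ i) < e / CARD('m)" by metis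
  have "dist (\<chi> i. padic_of_rat (q i)) x \<le> (\<Sum>i\<in>UNIV. dist (padic_of_rat (q i)) (x $ i))"
    unfolding dist_vec_def using L2_set_le_sum[of UNIV "\<lambda>i. dist (padic_of_rat (q i)) (x $ i)"] by simp
  also have "\<dots> < (\<Sum>i\<in>(UNIV :: 'm set). e / CARD('m))"
    using q by (intro sum_strict_mono) auto
  finally show ?thesis by (intro bexI[of _ "\<chi> i. padic_of_rat (q i)"]) auto
qed

lemma padic_norm_le_sup_norm: "padic_norm (v $ i) \<le> padic_sup_norm v"
  unfolding padic_sup_norm_def by (intro Max_ge) auto

text \<open>Converts avoidance of a supremum-norm ball into a lower bound for \<open>dist\<close>,
  in which the covering balls are measured.\<close>

lemma padic_sup_norm_le_dist: "padic_sup_norm (x - y) \<le> dist x y"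
  unfolding padic_sup_norm_def
  by (subst Max_le_iff) (auto simp: dist_vec_nth_le simp flip: dist_padic_def)

theorem theorem1p10:
  fixes \<delta> :: real
  assumes "CARD('m::finite) \<ge> 2" and "\<delta> > 0"
  shows "(\<forall>F :: 'm::finite \<Rightarrow> ('d::finite, real) mpolynomial.
            lin_indep_family (with_one F) \<longrightarrow>
            (\<forall>B \<in> {ball 0 \<delta>, cball 0 \<delta>}.
               (borel_chromatic_number (Cay (pm_values F - B)), natLeq) \<in> ordIso)) \<and>
         (\<forall>F :: 'm::finite \<Rightarrow> ('d::finite, 'p::prime_card padic) mpolynomial.
            lin_indep_family (with_one F) \<longrightarrow>
            (\<forall>B \<in> {{v. padic_sup_norm v < \<delta>}, {v. padic_sup_norm v \<le> \<delta>}}.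
               (borel_chromatic_number (Cay (pm_values F - B)), natLeq) \<in> ordIso))"
proof (intro conjI allI impI ballI)
  fix F :: "'m \<Rightarrow> ('d, real) mpolynomial" and B :: "(real ^ 'm) set"
  assume F: "lin_indep_family (with_one F)" and B: "B \<in> {ball 0 \<delta>, cball 0 \<delta>}"
  obtain D :: "(real ^ 'm) set" where D: "countable D"
    "\<And>X. open X \<Longrightarrow> X \<noteq> {} \<Longrightarrow> \<exists>d\<in>D. d \<in> X"
    using countable_dense_setE by blast
  show "(borel_chromatic_number (Cay (pm_values F - B)), natLeq) \<in> ordIso"
  proof (rule borel_chromatic_number_Cay[OF abs_value_real F _ _ D(1)])
    show "\<bar>v $ i\<bar> \<le> \<delta>" if "v \<in> B" for v i
      using that B component_le_norm_cart[of v i] by auto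
    show "\<delta> \<le> dist x y" if "x - y \<notin> B" for x y
      using that B by (auto simp: dist_norm)
    show "\<exists>d\<in>D. dist d x < \<delta> / 2" for x
      using D(2)[of "ball x (\<delta> / 2)"] assms(2) by (auto simp: dist_commute)
  qed
next
  fix F :: "'m \<Rightarrow> ('d, 'p padic) mpolynomial" and B :: "('p padic ^ 'm) set"
  assume F: "lin_indep_family (with_one F)"
    and B: "B \<in> {{v. padic_sup_norm v < \<delta>}, {v. padic_sup_norm v \<le> \<delta>}}"
  show "(borel_chromatic_number (Cay (pm_values F - B)), natLeq) \<in> ordIso"
  proof (rule borel_chromatic_number_Cay[OF abs_value_padic F])
    show "padic_norm (v $ i) \<le> \<delta>" if "v \<in> B" for v i
      using that B padic_norm_le_sup_norm[of v i] by auto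
    show "\<delta> \<le> dist x y" if "x - y \<notin> B" for x y
      using that B padic_sup_norm_le_dist[of x y] by auto
    show "\<exists>d\<in>range (\<lambda>q. \<chi> i. padic_of_rat (q i)). dist d x < \<delta> / 2" for x :: "'p padic ^ 'm"
      using assms(2) by (intro padic_vec_dense) simp
  qed simp
qed

end
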